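(* Let $v$ be a weight on $\mathbb{C}$. Assume that there exist a sequence of real numbers $0<m_1<m_2<\dots$ with $\lim_{n\to\infty}m_n=\infty$ and constants $b>2$ and $K\ge b$ such that for each $n\in\mathbb{N}$ $$b\le \min\big(A(m_n,m_{n+1}),B(m_n,m_{n+1})\big)\le \max\big(A(m_n,m_{n+1}),B(m_n,m_{n+1})\big)\le K .$$ Then the solid hull of $H_v^\infty(\mathbb{C})$ is $$\Big\{(b_m)_{m=0}^\infty\in\mathbb{C}^{\{0,1,2,\dots\}} : \ \sup_{n\in\mathbb{N}} v(r_{m_n})\Big(\sum_{m_n<m\le m_{n+1}}|b_m|^2 r_{m_n}^{2m}\Big)^{1/2}<\infty\Big\},$$ where the inner summation is over integers $m$ with $m_n<m\le m_{n+1}$.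
   Context: $\mathbb{N}=\{1,2,3,\dots\}$. A weight $v$ is a continuous function $v:[0,\infty)\to(0,\infty)$ which is non-increasing on $[0,\infty)$ and rapidly decreasing, i.e. $\lim_{r\to\infty}r^m v(r)=0$ for each $m\in\mathbb{N}$; it is extended to $\mathbb{C}$ by $v(z):=v(|z|)$. $H_v^\infty(\mathbb{C})$ is the Banach space of entire functions $f$ with $\|f\|_v:=\sup_{z\in\mathbb{C}}v(z)|f(z)|<\infty$. An entire function $f(z)=\sum_{n=0}^\infty a_nz^n$ is identified with its sequence of Taylor coefficients $(a_n)_{n=0}^\infty$, so that $H_v^\infty(\mathbb{C})$ is regarded as a space of complex sequences. For a vector space $A$ of complex sequences containing all finitely supported sequences, the solid hull of $A$ is $S(A)=\{(c_n)_{n\ge0} : \exists (a_n)_{n\ge 0}\in A \text{ such that } |c_n|\le|a_n| \text{ for all } n\}$. For real $m>0$, $r_m$ denotes a (fixed) global maximum point of $r\mapsto r^m v(r)$ on $[0,\infty)$. For real numbers $0<m<n$, $$A(m,n):=\Big(\frac{r_m}{r_n}\Big)^m\frac{v(r_m)}{v(r_n)},\qquad B(m,n):=\Big(\frac{r_n}{r_m}\Big)^n\frac{v(r_n)}{v(r_m)} .$$ *)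

theory Defs
  imports "HOL-Complex_Analysis.Complex_Analysis"
begin

text \<open>
  A weight lives on \<open>[0, \<infinity>)\<close>; the values of \<open>v\<close> at negative reals are irrelevant everywhere below.
\<close>
definition weight :: "(real \<Rightarrow> real) \<Rightarrow> bool" where
  "weight v \<longleftrightarrow>
     continuous_on {0..} v \<and> (\<forall>s\<ge>0. 0 < v s) \<and> antimono_on {0..} v \<and>
     (\<forall>k::nat. 1 \<le> k \<longrightarrow> ((\<lambda>s. s ^ k * v s) \<longlongrightarrow> 0) at_top)"

text \<open>
  Finiteness of the supremum norm is expressed as boundedness above, because the real-valued
  \<open>SUP\<close> is unspecified on unbounded sets.
\<close>
definition H_inf :: "(real \<Rightarrow> real) \<Rightarrow> (complex \<Rightarrow> complex) set" where
  "H_inf v = {f. f holomorphic_on UNIV \<and> bdd_above (range (\<lambda>z. v (norm z) * norm (f z)))}"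

definition taylor_coeffs :: "(complex \<Rightarrow> complex) \<Rightarrow> nat \<Rightarrow> complex" where
  "taylor_coeffs f = fps_nth (fps_expansion f 0)"

definition solid_hull :: "(nat \<Rightarrow> complex) set \<Rightarrow> (nat \<Rightarrow> complex) set" where
  "solid_hull S = {c. \<exists>a\<in>S. \<forall>n. norm (c n) \<le> norm (a n)}"

text \<open>
  \<open>r\<close> is a choice of one global maximum point \<open>r m\<close> of \<open>s \<mapsto> s\<^sup>m v(s)\<close> on \<open>[0, \<infinity>)\<close> for each
  real \<open>m > 0\<close>. Note that \<open>0 powr m = 0\<close>, as required here.
\<close>
definition max_points :: "(real \<Rightarrow> real) \<Rightarrow> (real \<Rightarrow> real) \<Rightarrow> bool" where
  "max_points v r \<longleftrightarrow> (\<forall>m>0. is_arg_max (\<lambda>s. s powr m * v s) (\<lambda>s. 0 \<le> s) (r m))"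

definition A_quot :: "(real \<Rightarrow> real) \<Rightarrow> (real \<Rightarrow> real) \<Rightarrow> real \<Rightarrow> real \<Rightarrow> real" where
  "A_quot v r m n = (r m / r n) powr m * (v (r m) / v (r n))"

definition B_quot :: "(real \<Rightarrow> real) \<Rightarrow> (real \<Rightarrow> real) \<Rightarrow> real \<Rightarrow> real \<Rightarrow> real" where
  "B_quot v r m n = (r n / r m) powr n * (v (r n) / v (r m))"

end

theory Submission
  imports Defs
begin

text \<open>
  Write \<open>r_n\<close> for the maximum point belonging to \<open>m_n\<close>. One inclusion is Bessel's inequality on the
  circle of radius \<open>r_n\<close>. For the other one, every block \<open>(b_j)\<close>, \<open>m_n < j \<le> m_{n+1}\<close>, is majorized by
  the coefficients of a polynomial with spectrum in exactly the same block, whose supremum on the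
  circle of radius \<open>r_n\<close> is at most a constant times the weighted \<open>\<ell>\<^sup>2\<close> norm of the block. The maximum
  principle on both sides of that circle and the bounds \<open>b > 2\<close>, \<open>K\<close> on the quotients make the
  contributions of the blocks to any other circle decay geometrically, so the polynomials add up to
  a function in the space.

  The polynomial majorant is a theorem of Kislyakov (de Leeuw--Kahane--Katznelson for polynomials of
  a given degree). Choose signs such that \<open>F = \<Sum> \<plusminus>c_j z\<^sup>j\<close> has a bounded \<open>L\<^sup>4\<close> norm. The polynomial \<open>G\<close>
  of the same degree minimizing \<open>\<parallel>F - G\<parallel>\<^sup>2\<close> plus the squared distances of its values at finitely many
  points of the circle to a disc of radius \<open>\<kappa>\<close> is bounded by a multiple of \<open>\<kappa>\<close>, and by stationarity
  \<open>F - G\<close> is the truncated Fourier series of a measure. Kolmogorov's \<open>L\<^sup>1\<close> to \<open>L\<^sup>1\<^sup>/\<^sup>2\<close> estimate for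
  such series then shows that \<open>F - G\<close> is small in \<open>L\<^sup>2\<close> if \<open>\<kappa>\<close> is large. The indices at which \<open>G\<close> is
  too small are repaired by iteration.
\<close>

section \<open>Means over the unit circle\<close>

text \<open>Normalized arc length, parametrized over the unit interval. The codomain is a general
  Banach space so that complex Fourier integrals and real means of norms share one set of
  rules.\<close>

definition circle_mean :: "(complex \<Rightarrow> 'a::banach) \<Rightarrow> 'a" where
  "circle_mean f = integral {0..1} (\<lambda>t. f (cis (2 * pi * t)))"

abbreviation tpoly :: "nat \<Rightarrow> (nat \<Rightarrow> complex) \<Rightarrow> complex \<Rightarrow> complex" where
  "tpoly N a z \<equiv> \<Sum>j<N. a j * z ^ j"

lemma circle_integrable:
  fixes f :: "complex \<Rightarrow> 'a::banach"
  assumes "continuous_on (sphere 0 1) f"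
  shows "(\<lambda>t. f (cis (2 * pi * t))) integrable_on {0..1}"
proof -
  have "continuous_on {0..1} (\<lambda>t. f (cis (2 * pi * t)))"
    by (rule continuous_on_compose2[OF assms]) (auto intro!: continuous_intros)
  then show ?thesis by (rule integrable_continuous_interval)
qed

lemma circle_mean_mono:
  fixes f g :: "complex \<Rightarrow> real"
  assumes "continuous_on (sphere 0 1) f" "continuous_on (sphere 0 1) g"
    and "\<And>z. norm z = 1 \<Longrightarrow> f z \<le> g z"
  shows "circle_mean f \<le> circle_mean g"
  unfolding circle_mean_def
  by (rule integral_le) (use assms circle_integrable in auto)

lemma circle_mean_add:
  assumes "continuous_on (sphere 0 1) f" "continuous_on (sphere 0 1) g"
  shows "circle_mean (\<lambda>z. f z + g z) = circle_mean f + circle_mean g"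
  unfolding circle_mean_def
  by (rule integral_add) (use assms circle_integrable in auto)

lemma circle_mean_mult:
  fixes f :: "complex \<Rightarrow> 'a::{banach,real_normed_field}"
  shows "circle_mean (\<lambda>z. c * f z) = c * circle_mean f"
  unfolding circle_mean_def by simp

lemma circle_mean_sum:
  assumes "\<And>i. i \<in> I \<Longrightarrow> continuous_on (sphere 0 1) (f i)" "finite I"
  shows "circle_mean (\<lambda>z. \<Sum>i\<in>I. f i z) = (\<Sum>i\<in>I. circle_mean (f i))"
  unfolding circle_mean_def
  by (rule integral_sum) (use assms circle_integrable in auto)

lemma circle_mean_const [simp]: "circle_mean (\<lambda>_. c) = c"
  unfolding circle_mean_def by simp

lemma circle_mean_cong:
  "(\<And>z. norm z = 1 \<Longrightarrow> f z = g z) \<Longrightarrow> circle_mean f = circle_mean g"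
  unfolding circle_mean_def by (rule integral_cong) simp

lemma circle_mean_of_real:
  assumes "continuous_on (sphere 0 1) f"
  shows "circle_mean (\<lambda>z. complex_of_real (f z)) = of_real (circle_mean f)"
  unfolding circle_mean_def using integral_linear[OF circle_integrable[OF assms] bounded_linear_of_real]
  by (simp add: o_def)

lemma circle_mean_Re:
  assumes "continuous_on (sphere 0 1) f"
  shows "circle_mean (\<lambda>z. Re (f z)) = Re (circle_mean f)"
  unfolding circle_mean_def using integral_linear[OF circle_integrable[OF assms] bounded_linear_Re]
  by (simp add: o_def)

lemma circle_mean_norm_le:
  fixes f :: "complex \<Rightarrow> complex"
  assumes "continuous_on (sphere 0 1) f"
  shows "norm (circle_mean f) \<le> circle_mean (\<lambda>z. norm (f z))"
  unfolding circle_mean_def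
  by (rule integral_norm_bound_integral)
     (use circle_integrable[OF assms] circle_integrable[OF continuous_on_norm[OF assms]] in auto)

lemma circle_mean_monomials:
  "circle_mean (\<lambda>z. z ^ j * cnj (z ^ k)) = (if j = k then 1 else 0)"
proof (cases "j = k")
  case True
  have "circle_mean (\<lambda>z. z ^ j * cnj (z ^ k)) = circle_mean (\<lambda>_. 1)"
    by (rule circle_mean_cong) (simp only: True complex_norm_square[symmetric] norm_power, simp)
  then show ?thesis using True by simp
next
  case False
  \<comment> \<open>This is a nonzero integer multiple of 2 pi, so the antiderivative of
    \<open>cis (c * t)\<close> takes the same value at both ends.\<close>
  define c where "c = 2 * pi * (real j - real k)"
  have c: "c \<noteq> 0" using False by (simp add: c_def)
  have eq: "cis (2 * pi * t) ^ j * cnj (cis (2 * pi * t) ^ k) = cis (c * t)" for t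
    by (simp add: Complex.DeMoivre cis_mult cis_cnj c_def algebra_simps flip: complex_cnj_power)
  have "((\<lambda>t. cis (c * t)) has_integral (cis (c * 1) / (\<i> * c) - cis (c * 0) / (\<i> * c))) {0..1}"
  proof (rule fundamental_theorem_of_calculus)
    fix x :: real
    have "((\<lambda>z. exp (\<i> * c * z) / (\<i> * c)) has_field_derivative exp (\<i> * c * of_real x)) (at (of_real x))"
      using c by (auto intro!: derivative_eq_intros)
    from has_vector_derivative_real_field[OF this]
    show "((\<lambda>t. cis (c * t) / (\<i> * c)) has_vector_derivative cis (c * x)) (at x within {0..1})"
      by (simp add: cis_conv_exp mult_ac)
  qed auto
  moreover have "cis (c * 1) = 1"
  proof -
    have "cis c = cis (2 * pi * of_int (int j - int k))" by (simp add: c_def)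
    also have "\<dots> = 1" by (subst cis_multiple_2pi) auto
    finally show ?thesis by simp
  qed
  ultimately have "((\<lambda>t. cis (c * t)) has_integral 0) {0..1}" by simp
  then show ?thesis using False unfolding circle_mean_def eq by (simp add: integral_unique)
qed

lemma tpoly_parseval:
  "circle_mean (\<lambda>z. tpoly N a z * cnj (tpoly N b z)) = (\<Sum>j<N. a j * cnj (b j))"
proof -
  have "circle_mean (\<lambda>z. tpoly N a z * cnj (tpoly N b z))
      = circle_mean (\<lambda>z. \<Sum>j<N. \<Sum>k<N. (a j * cnj (b k)) * (z ^ j * cnj (z ^ k)))"
    by (simp add: sum_product mult_ac)
  also have "\<dots> = (\<Sum>j<N. \<Sum>k<N. (a j * cnj (b k)) * circle_mean (\<lambda>z. z ^ j * cnj (z ^ k)))"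
    by (subst circle_mean_sum, auto intro!: continuous_intros sum.cong simp: circle_mean_sum[OF _ finite_lessThan] circle_mean_mult
         simp del: complex_cnj_power)
       (subst circle_mean_sum, auto intro!: continuous_intros simp: circle_mean_mult simp del: complex_cnj_power)
  also have "\<dots> = (\<Sum>j<N. a j * cnj (b j))"
    unfolding circle_mean_monomials by (simp add: if_distrib[of "\<lambda>x. _ * x"] cong: if_cong)
  finally show ?thesis .
qed

lemma tpoly_parseval_norm:
  "circle_mean (\<lambda>z. (norm (tpoly N a z))\<^sup>2) = (\<Sum>j<N. (norm (a j))\<^sup>2)"
proof -
  have "complex_of_real (circle_mean (\<lambda>z. (norm (tpoly N a z))\<^sup>2))
      = circle_mean (\<lambda>z. tpoly N a z * cnj (tpoly N a z))"
    by (subst circle_mean_of_real[symmetric], intro continuous_intros) (simp only: complex_norm_square)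
  also have "\<dots> = of_real (\<Sum>j<N. (norm (a j))\<^sup>2)"
    unfolding tpoly_parseval of_real_sum complex_norm_square ..
  finally show ?thesis using of_real_eq_iff by blast
qed

text \<open>Mean value property. The radius stays strictly below 1 because the Cauchy transforms it
  is meant for have their poles on the unit circle.\<close>

lemma circle_mean_holomorphic:
  assumes "f holomorphic_on ball 0 1" "0 < \<rho>" "\<rho> < 1"
  shows "circle_mean (\<lambda>z. f (of_real \<rho> * z)) = f 0"
proof -
  have "f holomorphic_on cball 0 \<rho>"
    by (rule holomorphic_on_subset[OF assms(1)]) (use assms in auto)
  then have "((\<lambda>u. f u / (u - 0)) has_contour_integral (2 * of_real pi * \<i> * f 0)) (circlepath 0 \<rho>)"
    by (intro Cauchy_integral_circlepath_simple) (use assms in auto)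
  then have "((\<lambda>x. f (circlepath 0 \<rho> x) / (circlepath 0 \<rho> x) *
       vector_derivative (circlepath 0 \<rho>) (at x within {0..1})) has_integral (2 * of_real pi * \<i> * f 0)) {0..1}"
    by (simp add: has_contour_integral_def)
  moreover have "f (circlepath 0 \<rho> x) / (circlepath 0 \<rho> x) *
       vector_derivative (circlepath 0 \<rho>) (at x within {0..1})
      = 2 * of_real pi * \<i> * f (of_real \<rho> * cis (2 * pi * x))" if *: "0 \<le> x" "x \<le> 1" for x
    unfolding vector_derivative_circlepath01[OF *] using assms
    by (simp add: circlepath cis_conv_exp mult_ac)
  ultimately have "((\<lambda>x. 2 * of_real pi * \<i> * f (of_real \<rho> * cis (2 * pi * x)))
      has_integral (2 * of_real pi * \<i> * f 0)) {0..1}"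
    by (rule has_integral_eq[rotated]) auto
  from has_integral_mult_right[OF this, of "1 / (2 * of_real pi * \<i>)"]
  show ?thesis unfolding circle_mean_def by (simp add: integral_unique)
qed

section \<open>Kolmogorov's estimate for truncated Fourier series of discrete measures\<close>

text \<open>\<open>csqrt\<close> maps the closed right half plane into the sector of arguments at
  most pi/4 in modulus, where the modulus is at most sqrt 2 times the real part.\<close>

lemma sqrt_norm_le_Re_csqrt:
  assumes "0 \<le> Re w"
  shows "sqrt (norm w) \<le> sqrt 2 * Re (csqrt w)"
  using assms by (simp add: real_sqrt_divide)

lemma Re_one_over_one_minus_pos:
  fixes w :: complex
  assumes "norm w < 1"
  shows "0 < Re (1 / (1 - w))"
proof -
  have "Re w < 1" using assms complex_Re_le_cmod[of w] by linarith
  moreover have "1 - w \<noteq> 0" using assms by auto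
  ultimately show ?thesis by (simp add: Re_divide sum_power2_gt_zero_iff complex_eq_iff)
qed

text \<open>Kolmogorov's argument: the Cauchy transform of nonnegative, not all vanishing masses has
  positive real part in the disc, so its \<open>csqrt\<close> is holomorphic there. Up to the factor
  sqrt 2, the real part of this root dominates the integrand, and its mean is its value at the
  centre, the root of the total mass.\<close>

lemma cauchy_sum_half_mean_pos:
  fixes p :: "complex \<Rightarrow> real"
  assumes T: "finite T" "T \<subseteq> sphere 0 1" and p: "\<And>\<zeta>. 0 \<le> p \<zeta>" and \<rho>: "0 < \<rho>" "\<rho> < 1"
  shows "circle_mean (\<lambda>z. sqrt (norm (\<Sum>\<zeta>\<in>T. p \<zeta> / (1 - cnj \<zeta> * (of_real \<rho> * z)))))
      \<le> sqrt 2 * sqrt (\<Sum>\<zeta>\<in>T. p \<zeta>)"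
proof (cases "(\<Sum>\<zeta>\<in>T. p \<zeta>) = 0")
  case True
  then have "\<forall>\<zeta>\<in>T. p \<zeta> = 0" using T p by (simp add: sum_nonneg_eq_0_iff)
  then show ?thesis by simp
next
  case False
  define H where "H z = (\<Sum>\<zeta>\<in>T. p \<zeta> / (1 - cnj \<zeta> * z))" for z
  have lt: "norm (cnj \<zeta> * z) < 1" if "\<zeta> \<in> T" "norm z < 1" for \<zeta> z
    using that T by (auto simp: norm_mult)
  have holH: "H holomorphic_on ball 0 1" unfolding H_def
    using lt by (intro holomorphic_intros) force
  \<comment> \<open>A single nonzero mass makes \<open>Re (H z)\<close> strictly positive on the
    whole disc, which keeps \<open>H\<close> off the branch cut of \<open>csqrt\<close>.\<close>
  obtain \<zeta>0 where \<zeta>0: "\<zeta>0 \<in> T" "p \<zeta>0 \<noteq> 0" using False by (meson sum.neutral)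
  have ReH: "0 < Re (H z)" if "norm z < 1" for z
  proof -
    have "Re (p \<zeta> / (1 - cnj \<zeta> * z)) = p \<zeta> * Re (1 / (1 - cnj \<zeta> * z))" for \<zeta>
      using scaleR_complex.sel(1)[of "p \<zeta>" "1 / (1 - cnj \<zeta> * z)"] by (simp add: scaleR_conv_of_real)
    moreover have "0 < (\<Sum>\<zeta>\<in>T. p \<zeta> * Re (1 / (1 - cnj \<zeta> * z)))"
    proof (rule sum_pos2[OF T(1) \<zeta>0(1)])
      show "0 < p \<zeta>0 * Re (1 / (1 - cnj \<zeta>0 * z))"
        using Re_one_over_one_minus_pos[OF lt[OF \<zeta>0(1) that]] p[of \<zeta>0] \<zeta>0(2)
        by (intro mult_pos_pos) auto
      show "0 \<le> p \<zeta> * Re (1 / (1 - cnj \<zeta> * z))" if "\<zeta> \<in> T" for \<zeta>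
        using Re_one_over_one_minus_pos[OF lt[OF that \<open>norm z < 1\<close>]] p[of \<zeta>]
        by (intro mult_nonneg_nonneg) auto
    qed
    ultimately show ?thesis by (simp add: H_def)
  qed
  have "(\<lambda>z. csqrt (H z)) holomorphic_on ball 0 1"
    using ReH by (intro holomorphic_on_csqrt' holH) (force simp: complex_nonpos_Reals_iff)
  note hol = this
  have im: "(\<lambda>z::complex. of_real \<rho> * z) ` sphere 0 1 \<subseteq> ball 0 1"
    using \<rho> by (auto simp: norm_mult)
  have contH: "continuous_on (sphere 0 1) (\<lambda>z. H (of_real \<rho> * z))"
    by (rule continuous_on_compose2[OF holomorphic_on_imp_continuous_on[OF holH] _ im])
       (intro continuous_intros)
  have cont: "continuous_on (sphere 0 1) (\<lambda>z. csqrt (H (of_real \<rho> * z)))"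
    by (rule continuous_on_compose2[OF holomorphic_on_imp_continuous_on[OF hol] _ im])
       (intro continuous_intros)
  have "circle_mean (\<lambda>z. sqrt (norm (H (of_real \<rho> * z))))
      \<le> circle_mean (\<lambda>z. sqrt 2 * Re (csqrt (H (of_real \<rho> * z))))"
  proof (rule circle_mean_mono)
    show "continuous_on (sphere 0 1) (\<lambda>z. sqrt (norm (H (of_real \<rho> * z))))"
      by (intro continuous_intros contH)
    show "continuous_on (sphere 0 1) (\<lambda>z. sqrt 2 * Re (csqrt (H (of_real \<rho> * z))))"
      by (intro continuous_intros cont)
    show "sqrt (norm (H (of_real \<rho> * z))) \<le> sqrt 2 * Re (csqrt (H (of_real \<rho> * z)))"
      if "norm z = 1" for z
      by (rule sqrt_norm_le_Re_csqrt) (use ReH[of "of_real \<rho> * z"] that \<rho> in \<open>auto simp: norm_mult\<close>)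
  qed
  also have "\<dots> = sqrt 2 * Re (csqrt (H 0))"
    by (simp only: circle_mean_mult circle_mean_Re[OF cont] circle_mean_holomorphic[OF hol \<rho>])
  also have "csqrt (H 0) = of_real (sqrt (\<Sum>\<zeta>\<in>T. p \<zeta>))"
    using p by (simp add: H_def csqrt_of_real_nonneg sum_nonneg flip: of_real_sum)
  finally show ?thesis by (simp add: H_def)
qed

lemma sqrt_norm_add_le:
  fixes x y :: "'a::real_normed_vector"
  shows "sqrt (norm (x + y)) \<le> sqrt (norm x) + sqrt (norm y)"
  by (meson norm_ge_zero norm_triangle_ineq order_trans real_sqrt_le_mono sqrt_add_le_add_sqrt)

text \<open>Positive and negative parts of \<open>Re (g \<zeta>)\<close> and
  \<open>Im (g \<zeta>)\<close> reduce this to nonnegative masses. The root of the norm is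
  subadditive, so the four contributions add up, whence the factor 4.\<close>

lemma cauchy_sum_half_mean:
  fixes g :: "complex \<Rightarrow> complex"
  assumes T: "finite T" "T \<subseteq> sphere 0 1" and \<rho>: "0 < \<rho>" "\<rho> < 1"
  shows "circle_mean (\<lambda>z. sqrt (norm (\<Sum>\<zeta>\<in>T. g \<zeta> / (1 - cnj \<zeta> * (of_real \<rho> * z)))))
      \<le> 4 * sqrt 2 * sqrt (\<Sum>\<zeta>\<in>T. norm (g \<zeta>))"
proof -
  define H where "H p z = (\<Sum>\<zeta>\<in>T. complex_of_real (p \<zeta>) / (1 - cnj \<zeta> * (of_real \<rho> * z)))" for p :: "complex \<Rightarrow> real" and z
  let ?p1 = "\<lambda>\<zeta>. max (Re (g \<zeta>)) 0" and ?p2 = "\<lambda>\<zeta>. max (- Re (g \<zeta>)) 0"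
  let ?p3 = "\<lambda>\<zeta>. max (Im (g \<zeta>)) 0" and ?p4 = "\<lambda>\<zeta>. max (- Im (g \<zeta>)) 0"
  have ne: "1 - cnj \<zeta> * (of_real \<rho> * z) \<noteq> 0" if "\<zeta> \<in> T" "norm z = 1" for \<zeta> z
  proof
    assume "1 - cnj \<zeta> * (of_real \<rho> * z) = 0"
    then have "norm (cnj \<zeta> * (of_real \<rho> * z)) = 1" by (metis eq_iff_diff_eq_0 norm_one)
    then show False using that T \<rho> by (auto simp: norm_mult)
  qed
  have cont: "continuous_on (sphere 0 1) (\<lambda>z. sqrt (norm (H p z)))" for p
    unfolding H_def using ne by (intro continuous_intros) auto
  have bd: "circle_mean (\<lambda>z. sqrt (norm (H p z))) \<le> sqrt 2 * sqrt (\<Sum>\<zeta>\<in>T. norm (g \<zeta>))"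
    if "\<And>\<zeta>. 0 \<le> p \<zeta>" "\<And>\<zeta>. p \<zeta> \<le> norm (g \<zeta>)" for p
  proof -
    have "circle_mean (\<lambda>z. sqrt (norm (H p z))) \<le> sqrt 2 * sqrt (\<Sum>\<zeta>\<in>T. p \<zeta>)"
      unfolding H_def by (rule cauchy_sum_half_mean_pos) (use assms that in auto)
    also have "\<dots> \<le> sqrt 2 * sqrt (\<Sum>\<zeta>\<in>T. norm (g \<zeta>))"
      by (intro mult_left_mono real_sqrt_le_mono sum_mono) (use that in auto)
    finally show ?thesis .
  qed
  have g: "g \<zeta> = of_real (?p1 \<zeta>) - of_real (?p2 \<zeta>) + \<i> * of_real (?p3 \<zeta>) - \<i> * of_real (?p4 \<zeta>)" for \<zeta>
    by (auto simp: complex_eq_iff max_def)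
  have decomp: "(\<Sum>\<zeta>\<in>T. g \<zeta> / (1 - cnj \<zeta> * (of_real \<rho> * z)))
      = (H ?p1 z + - H ?p2 z) + (\<i> * H ?p3 z + - (\<i> * H ?p4 z))" for z
    unfolding H_def sum_distrib_left sum_negf[symmetric] sum.distrib[symmetric]
    by (rule sum.cong[OF refl]) (subst g, simp add: diff_divide_distrib add_divide_distrib)
  have "circle_mean (\<lambda>z. sqrt (norm (\<Sum>\<zeta>\<in>T. g \<zeta> / (1 - cnj \<zeta> * (of_real \<rho> * z)))))
      \<le> circle_mean (\<lambda>z. (sqrt (norm (H ?p1 z)) + sqrt (norm (H ?p2 z)))
          + (sqrt (norm (H ?p3 z)) + sqrt (norm (H ?p4 z))))"
  proof (rule circle_mean_mono)
    show "continuous_on (sphere 0 1) (\<lambda>z. sqrt (norm (\<Sum>\<zeta>\<in>T. g \<zeta> / (1 - cnj \<zeta> * (of_real \<rho> * z)))))"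
      using ne by (intro continuous_intros) auto
    show "sqrt (norm (\<Sum>\<zeta>\<in>T. g \<zeta> / (1 - cnj \<zeta> * (of_real \<rho> * z))))
      \<le> (sqrt (norm (H ?p1 z)) + sqrt (norm (H ?p2 z))) + (sqrt (norm (H ?p3 z)) + sqrt (norm (H ?p4 z)))" for z
      unfolding decomp
      by (intro order_trans[OF sqrt_norm_add_le] add_mono)
         (use sqrt_norm_add_le[of "H ?p1 z" "- H ?p2 z"] sqrt_norm_add_le[of "\<i> * H ?p3 z" "- (\<i> * H ?p4 z)"]
           in \<open>simp_all add: norm_mult\<close>)
  qed (intro continuous_intros cont)
  also have "\<dots> = (circle_mean (\<lambda>z. sqrt (norm (H ?p1 z))) + circle_mean (\<lambda>z. sqrt (norm (H ?p2 z))))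
      + (circle_mean (\<lambda>z. sqrt (norm (H ?p3 z))) + circle_mean (\<lambda>z. sqrt (norm (H ?p4 z))))"
    by (simp add: circle_mean_add cont continuous_on_add)
  also have "\<dots> \<le> 4 * (sqrt 2 * sqrt (\<Sum>\<zeta>\<in>T. norm (g \<zeta>)))"
  proof -
    have "max (Re (g \<zeta>)) 0 \<le> norm (g \<zeta>)" "max (- Re (g \<zeta>)) 0 \<le> norm (g \<zeta>)"
      "max (Im (g \<zeta>)) 0 \<le> norm (g \<zeta>)" "max (- Im (g \<zeta>)) 0 \<le> norm (g \<zeta>)" for \<zeta>
      using abs_Re_le_cmod[of "g \<zeta>"] abs_Im_le_cmod[of "g \<zeta>"] by auto
    then show ?thesis
      using bd[of ?p1] bd[of ?p2] bd[of ?p3] bd[of ?p4] by fastforce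
  qed
  finally show ?thesis by simp
qed

text \<open>
  The truncated series is the Cauchy transform of \<open>g\<close> minus \<open>z\<^sup>N\<close> times that of \<open>g\<close> modulated by
  \<open>cnj \<zeta>\<^sup>N\<close>, which has the same total mass; this makes the constant independent of \<open>N\<close>.
\<close>
lemma tpoly_half_mean:
  fixes g :: "complex \<Rightarrow> complex"
  assumes T: "finite T" "T \<subseteq> sphere 0 1"
  shows "circle_mean (\<lambda>z. sqrt (norm (tpoly N (\<lambda>j. \<Sum>\<zeta>\<in>T. g \<zeta> * cnj \<zeta> ^ j) z)))
      \<le> 8 * sqrt 2 * sqrt (\<Sum>\<zeta>\<in>T. norm (g \<zeta>))"
proof -
  define y where "y z = tpoly N (\<lambda>j. \<Sum>\<zeta>\<in>T. g \<zeta> * cnj \<zeta> ^ j) z" for z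
  define h where "h \<zeta> = g \<zeta> * cnj \<zeta> ^ N" for \<zeta>
  define B where "B = 8 * sqrt 2 * sqrt (\<Sum>\<zeta>\<in>T. norm (g \<zeta>))"
  define C where "C f z = (\<Sum>\<zeta>\<in>T. f \<zeta> / (1 - cnj \<zeta> * z))" for f :: "complex \<Rightarrow> complex" and z
  have sumh: "(\<Sum>\<zeta>\<in>T. norm (h \<zeta>)) = (\<Sum>\<zeta>\<in>T. norm (g \<zeta>))"
    using T by (intro sum.cong) (auto simp: h_def norm_mult norm_power)
  have ne: "1 - cnj \<zeta> * z \<noteq> 0" if "\<zeta> \<in> T" "norm z < 1" for \<zeta> z
  proof
    assume "1 - cnj \<zeta> * z = 0"
    then have "norm (cnj \<zeta> * z) = 1" by (metis eq_iff_diff_eq_0 norm_one)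
    then show False using that T by (auto simp: norm_mult)
  qed
  have y_eq: "y z = C g z - z ^ N * C h z" if "norm z < 1" for z
  proof -
    have "y z = (\<Sum>\<zeta>\<in>T. g \<zeta> * (\<Sum>j<N. (cnj \<zeta> * z) ^ j))"
      unfolding y_def sum_distrib_left sum_distrib_right
      by (subst sum.swap) (simp add: power_mult_distrib mult_ac)
    also have "\<dots> = (\<Sum>\<zeta>\<in>T. g \<zeta> / (1 - cnj \<zeta> * z) - z ^ N * (h \<zeta> / (1 - cnj \<zeta> * z)))"
    proof (rule sum.cong[OF refl])
      fix \<zeta> assume "\<zeta> \<in> T"
      then have "cnj \<zeta> * z \<noteq> 1" using ne[of \<zeta> z] that by auto
      then have gp: "(\<Sum>j<N. (cnj \<zeta> * z) ^ j) = (1 - (cnj \<zeta> * z) ^ N) / (1 - cnj \<zeta> * z)"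
        using sum_gp_strict[of "cnj \<zeta> * z" N] by auto
      show "g \<zeta> * (\<Sum>j<N. (cnj \<zeta> * z) ^ j) = g \<zeta> / (1 - cnj \<zeta> * z) - z ^ N * (h \<zeta> / (1 - cnj \<zeta> * z))"
        unfolding gp by (simp add: h_def power_mult_distrib diff_divide_distrib algebra_simps)
    qed
    finally show ?thesis by (simp add: C_def sum_subtractf sum_distrib_left)
  qed
  have le: "circle_mean (\<lambda>z. sqrt (norm (y (of_real \<rho> * z)))) \<le> B" if \<rho>: "0 < \<rho>" "\<rho> < 1" for \<rho>
  proof -
    have cont: "continuous_on (sphere 0 1) (\<lambda>z. sqrt (norm (C f (of_real \<rho> * z))))" for f
      unfolding C_def using ne \<rho> by (intro continuous_intros) (auto simp: norm_mult)
    have "circle_mean (\<lambda>z. sqrt (norm (y (of_real \<rho> * z))))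
        \<le> circle_mean (\<lambda>z. sqrt (norm (C g (of_real \<rho> * z))) + sqrt (norm (C h (of_real \<rho> * z))))"
    proof (rule circle_mean_mono)
      show "continuous_on (sphere 0 1) (\<lambda>z. sqrt (norm (y (of_real \<rho> * z))))"
        unfolding y_def by (intro continuous_intros)
      fix z :: complex assume z: "norm z = 1"
      let ?w = "of_real \<rho> * z"
      have w: "norm ?w < 1" using z \<rho> by (simp add: norm_mult)
      have "sqrt (norm (y ?w)) \<le> sqrt (norm (C g ?w)) + sqrt (norm (- (?w ^ N * C h ?w)))"
        using sqrt_norm_add_le[of "C g ?w" "- (?w ^ N * C h ?w)"] y_eq[OF w] by simp
      also have "sqrt (norm (- (?w ^ N * C h ?w))) \<le> sqrt (norm (C h ?w))"
        using w by (simp add: norm_mult norm_power z mult_left_le_one_le power_le_one)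
      finally show "sqrt (norm (y ?w)) \<le> sqrt (norm (C g ?w)) + sqrt (norm (C h ?w))" by simp
    qed (intro continuous_intros cont)
    also have "\<dots> = circle_mean (\<lambda>z. sqrt (norm (C g (of_real \<rho> * z)))) + circle_mean (\<lambda>z. sqrt (norm (C h (of_real \<rho> * z))))"
      by (rule circle_mean_add[OF cont cont])
    also have "\<dots> \<le> 4 * sqrt 2 * sqrt (\<Sum>\<zeta>\<in>T. norm (g \<zeta>)) + 4 * sqrt 2 * sqrt (\<Sum>\<zeta>\<in>T. norm (h \<zeta>))"
      unfolding C_def by (intro add_mono cauchy_sum_half_mean assms \<rho>)
    finally show ?thesis by (simp add: sumh B_def)
  qed
  \<comment> \<open>The estimate is known on circles of radius \<rho> < 1. As \<open>y\<close> is a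
    polynomial, the mean is continuous in \<rho> up to 1, and the bound passes to the limit.\<close>
  have "continuous_on {0..1} (\<lambda>\<rho>. integral (cbox 0 1) (\<lambda>t. sqrt (norm (y (of_real \<rho> * cis (2 * pi * t))))))"
    unfolding y_def by (rule integral_continuous_on_param) (auto intro!: continuous_intros simp: case_prod_unfold)
  then have "continuous_on {0..1} (\<lambda>\<rho>. circle_mean (\<lambda>z. sqrt (norm (y (of_real \<rho> * z)))))"
    by (simp add: circle_mean_def cbox_interval)
  then have "((\<lambda>\<rho>. circle_mean (\<lambda>z. sqrt (norm (y (of_real \<rho> * z)))))
      \<longlongrightarrow> circle_mean (\<lambda>z. sqrt (norm (y (of_real 1 * z))))) (at 1 within {0..1})"
    unfolding continuous_on_def by (rule bspec) simp
  then have "((\<lambda>\<rho>. circle_mean (\<lambda>z. sqrt (norm (y (of_real \<rho> * z)))))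
      \<longlongrightarrow> circle_mean (\<lambda>z. sqrt (norm (y (of_real 1 * z))))) (at 1 within {0<..<1})"
    by (rule tendsto_within_subset) auto
  moreover have "\<forall>\<^sub>F \<rho> in at 1 within {0<..<1}. circle_mean (\<lambda>z. sqrt (norm (y (of_real \<rho> * z)))) \<le> B"
    using le by (auto simp: eventually_at_filter)
  moreover have "at (1::real) within {0<..<1} \<noteq> bot"
    by (simp add: at_within_eq_bot_iff)
  ultimately have "circle_mean (\<lambda>z. sqrt (norm (y (of_real 1 * z)))) \<le> B"
    by (intro tendsto_upperbound)
  then show ?thesis by (simp add: y_def B_def)
qed

section \<open>Bounded polynomials close to a sign change of given coefficients\<close>

text \<open>A deterministic form of Khinchin's inequality. With old mass s and new mass q, the
  fourth-power mean averaged over the two signs of the new term is at most 3 s^2 + 6 q s + q^2,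
  hence at most 3 (s + q)^2, so one of the two signs preserves the bound.\<close>

lemma fourth_power_sign_choice:
  fixes c :: "nat \<Rightarrow> complex"
  shows "\<exists>\<epsilon>::nat \<Rightarrow> real. (\<forall>j. \<bar>\<epsilon> j\<bar> = (1::real)) \<and>
    circle_mean (\<lambda>z. norm (tpoly N (\<lambda>j. \<epsilon> j * c j) z) ^ 4) \<le> 3 * (\<Sum>j<N. (norm (c j))\<^sup>2)\<^sup>2"
proof (induction N)
  case 0
  show ?case by (intro exI[of _ "\<lambda>_. 1"]) simp
next
  case (Suc N)
  then obtain \<epsilon> :: "nat \<Rightarrow> real" where \<epsilon>: "\<And>j. \<bar>\<epsilon> j\<bar> = 1"
    and le: "circle_mean (\<lambda>z. norm (tpoly N (\<lambda>j. \<epsilon> j * c j) z) ^ 4) \<le> 3 * (\<Sum>j<N. (norm (c j))\<^sup>2)\<^sup>2"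
    by blast
  define u where "u z = tpoly N (\<lambda>j. \<epsilon> j * c j) z" for z
  define w where "w z = c N * z ^ N" for z
  define s where "s = (\<Sum>j<N. (norm (c j))\<^sup>2)"
  define q where "q = (norm (c N))\<^sup>2"
  have cont [continuous_intros]: "continuous_on A u" "continuous_on A w" for A
    unfolding u_def w_def by (intro continuous_intros)+
  \<comment> \<open>The terms odd in the inner product t cancel when both signs are added; the
    remaining 8 t^2 is controlled by Cauchy-Schwarz.\<close>
  have pt: "norm (u z + w z) ^ 4 + norm (u z - w z) ^ 4 \<le> 2 * (norm (u z) ^ 4 + 6 * q * (norm (u z))\<^sup>2 + q\<^sup>2)"
    if "norm z = 1" for z
  proof -
    define t where "t = inner (u z) (w z)"
    have q: "(norm (w z))\<^sup>2 = q" by (simp add: w_def q_def norm_mult norm_power that)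
    have "t\<^sup>2 \<le> (norm (u z))\<^sup>2 * q"
      using Cauchy_Schwarz_ineq[of "u z" "w z"] by (simp add: t_def flip: q power2_norm_eq_inner)
    moreover have "(norm (u z + w z))\<^sup>2 = (norm (u z))\<^sup>2 + q + 2 * t"
      "(norm (u z - w z))\<^sup>2 = (norm (u z))\<^sup>2 + q - 2 * t"
      unfolding q[symmetric] power2_norm_eq_inner t_def
      by (simp_all add: inner_add_left inner_add_right inner_diff_left inner_diff_right inner_commute)
    then have "norm (u z + w z) ^ 4 = ((norm (u z))\<^sup>2 + q + 2 * t)\<^sup>2"
      "norm (u z - w z) ^ 4 = ((norm (u z))\<^sup>2 + q - 2 * t)\<^sup>2"
      by (metis mult_2 numeral_Bit0 power_even_eq)+
    moreover have "norm (u z) ^ 4 = ((norm (u z))\<^sup>2)\<^sup>2" by simp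
    ultimately show ?thesis by (simp only:) (simp add: power2_eq_square algebra_simps)
  qed
  have "circle_mean (\<lambda>z. norm (u z + w z) ^ 4) + circle_mean (\<lambda>z. norm (u z - w z) ^ 4)
      = circle_mean (\<lambda>z. norm (u z + w z) ^ 4 + norm (u z - w z) ^ 4)"
    by (rule circle_mean_add[symmetric]) (intro continuous_intros)+
  also have "\<dots> \<le> circle_mean (\<lambda>z. 2 * (norm (u z) ^ 4 + 6 * q * (norm (u z))\<^sup>2 + q\<^sup>2))"
    by (rule circle_mean_mono) (intro continuous_intros, intro continuous_intros, rule pt)
  also have "\<dots> = 2 * (circle_mean (\<lambda>z. norm (u z) ^ 4) + 6 * q * circle_mean (\<lambda>z. (norm (u z))\<^sup>2) + q\<^sup>2)"
    by (simp add: circle_mean_mult circle_mean_add continuous_intros)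
  also have "circle_mean (\<lambda>z. (norm (u z))\<^sup>2) = s"
    unfolding u_def tpoly_parseval_norm s_def by (simp add: norm_mult \<epsilon>)
  also have "circle_mean (\<lambda>z. norm (u z) ^ 4) \<le> 3 * s\<^sup>2"
    using le by (simp add: u_def s_def)
  finally have sum: "circle_mean (\<lambda>z. norm (u z + w z) ^ 4) + circle_mean (\<lambda>z. norm (u z - w z) ^ 4)
      \<le> 2 * (3 * s\<^sup>2 + 6 * q * s + q\<^sup>2)" by simp
  have "3 * s\<^sup>2 + 6 * q * s + q\<^sup>2 \<le> 3 * (s + q)\<^sup>2"
    by (simp add: power2_eq_square algebra_simps)
  then have "circle_mean (\<lambda>z. norm (u z + 1 * w z) ^ 4) \<le> 3 * (s + q)\<^sup>2
      \<or> circle_mean (\<lambda>z. norm (u z + (-1) * w z) ^ 4) \<le> 3 * (s + q)\<^sup>2"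
    using sum by auto
  then obtain \<sigma> :: real where \<sigma>: "\<bar>\<sigma>\<bar> = 1"
    and le': "circle_mean (\<lambda>z. norm (u z + of_real \<sigma> * w z) ^ 4) \<le> 3 * (s + q)\<^sup>2"
    by (elim disjE) (use that[of 1] that[of "-1"] in simp_all)
  have "tpoly (Suc N) (\<lambda>j. (\<epsilon>(N := \<sigma>)) j * c j) z = u z + of_real \<sigma> * w z" for z
    by (simp add: u_def w_def mult_ac)
  then show ?case
    using \<epsilon> \<sigma> le' by (intro exI[of _ "\<epsilon>(N := \<sigma>)"]) (simp add: s_def q_def)
qed

text \<open>
  Integrated over the circle, this replaces Hoelder interpolation of \<open>y\<close> between \<open>L\<^sup>1\<^sup>/\<^sup>2\<close> and \<open>L\<^sup>2\<close>.
\<close>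
lemma product_split_bound:
  fixes x y \<tau> L :: real
  assumes "0 \<le> x" "0 \<le> y" "0 < \<tau>" "0 < L"
  shows "x * y \<le> \<tau> * y\<^sup>2 + x ^ 4 / (L\<^sup>2 * \<tau>) + sqrt (L ^ 3 / \<tau>) * sqrt y"
proof -
  have nn: "0 \<le> \<tau> * y\<^sup>2" "0 \<le> x ^ 4 / (L\<^sup>2 * \<tau>)" "0 \<le> sqrt (L ^ 3 / \<tau>) * sqrt y"
    using assms by auto
  consider "x \<le> \<tau> * y" | "\<tau> * y < x" "L < x" | "\<tau> * y < x" "x \<le> L" by linarith
  then show ?thesis
  proof cases
    case 1
    then have "x * y \<le> \<tau> * y\<^sup>2"
      using assms by (simp add: power2_eq_square mult_right_mono flip: mult.assoc)
    then show ?thesis using nn by linarith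
  next
    case 2
    then have "y \<le> x / \<tau>" using assms by (simp add: field_simps)
    then have "x * y \<le> x * (x / \<tau>)" using assms by (intro mult_left_mono) auto
    also have "\<dots> = L\<^sup>2 * x\<^sup>2 / (L\<^sup>2 * \<tau>)" using assms by (simp add: power2_eq_square)
    also have "\<dots> \<le> x\<^sup>2 * x\<^sup>2 / (L\<^sup>2 * \<tau>)"
      using assms 2 by (intro divide_right_mono mult_right_mono power_mono) auto
    also have "\<dots> = x ^ 4 / (L\<^sup>2 * \<tau>)" by simp
    finally show ?thesis using nn by linarith
  next
    case 3
    then have "y \<le> L / \<tau>" using assms by (simp add: field_simps)
    have "x * y = x * sqrt y * sqrt y" using assms by simp
    also have "\<dots> \<le> L * sqrt (L / \<tau>) * sqrt y"
      using assms 3 \<open>y \<le> L / \<tau>\<close> by (intro mult_right_mono mult_mono) auto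
    also have "L * sqrt (L / \<tau>) = sqrt (L ^ 3 / \<tau>)"
    proof -
      have "L ^ 3 / \<tau> = L\<^sup>2 * (L / \<tau>)" by (simp add: power3_eq_cube power2_eq_square)
      then show ?thesis using assms by (simp only: real_sqrt_mult) simp
    qed
    finally show ?thesis using nn by linarith
  qed
qed

lemma pairing_bound_normalized:
  fixes a :: "nat \<Rightarrow> complex" and g :: "complex \<Rightarrow> complex"
  assumes T: "finite T" "T \<subseteq> sphere 0 1" and "0 < \<delta>"
    and a: "circle_mean (\<lambda>z. norm (tpoly N a z) ^ 4) \<le> 3"
    and y: "\<And>j. y j = (\<Sum>\<zeta>\<in>T. g \<zeta> * cnj \<zeta> ^ j)"
    and Y: "(\<Sum>j<N. (norm (y j))\<^sup>2) = 1"
  shows "norm (\<Sum>j<N. a j * cnj (y j)) \<le> \<delta> + 175616 / \<delta> ^ 5 * (\<Sum>\<zeta>\<in>T. norm (g \<zeta>))"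
proof -
  define A where "A = (\<Sum>\<zeta>\<in>T. norm (g \<zeta>))"
  have A0: "0 \<le> A" by (simp add: A_def sum_nonneg)
  define D where "D = sqrt (1372 / \<delta> ^ 4)"
  \<comment> \<open>With \<tau> = \<delta>/4 and L = 7/\<delta> in
    \<open>product_split_bound\<close>, the first two terms integrate to at most \<delta>/4 and 12
    \<delta>/49, together less than \<delta>/2.\<close>
  have L: "(7 / \<delta>) ^ 3 / (\<delta> / 4) = 1372 / \<delta> ^ 4" "(7 / \<delta>)\<^sup>2 * (\<delta> / 4) = 49 / (4 * \<delta>)"
    using \<open>0 < \<delta>\<close> by (simp_all add: power_divide power2_eq_square field_simps eval_nat_numeral)
  have "norm (\<Sum>j<N. a j * cnj (y j)) = norm (circle_mean (\<lambda>z. tpoly N a z * cnj (tpoly N y z)))"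
    by (simp only: tpoly_parseval)
  also have "\<dots> \<le> circle_mean (\<lambda>z. norm (tpoly N a z * cnj (tpoly N y z)))"
    by (rule circle_mean_norm_le) (intro continuous_intros)
  also have "\<dots> = circle_mean (\<lambda>z. norm (tpoly N a z) * norm (tpoly N y z))"
    by (simp only: norm_mult complex_mod_cnj)
  also have "\<dots> \<le> circle_mean (\<lambda>z. \<delta> / 4 * (norm (tpoly N y z))\<^sup>2
      + norm (tpoly N a z) ^ 4 / (49 / (4 * \<delta>)) + D * sqrt (norm (tpoly N y z)))"
  proof (rule circle_mean_mono)
    show "norm (tpoly N a z) * norm (tpoly N y z) \<le> \<delta> / 4 * (norm (tpoly N y z))\<^sup>2
      + norm (tpoly N a z) ^ 4 / (49 / (4 * \<delta>)) + D * sqrt (norm (tpoly N y z))" for z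
      using product_split_bound[of "norm (tpoly N a z)" "norm (tpoly N y z)" "\<delta> / 4" "7 / \<delta>"] \<open>0 < \<delta>\<close>
      unfolding L D_def by simp
  qed (use \<open>0 < \<delta>\<close> in \<open>intro continuous_intros; simp\<close>)+
  also have "\<dots> = \<delta> / 4 * circle_mean (\<lambda>z. (norm (tpoly N y z))\<^sup>2)
      + 4 * \<delta> / 49 * circle_mean (\<lambda>z. norm (tpoly N a z) ^ 4) + D * circle_mean (\<lambda>z. sqrt (norm (tpoly N y z)))"
  proof -
    have *: "norm (tpoly N a z) ^ 4 / (49 / (4 * \<delta>)) = 4 * \<delta> / 49 * norm (tpoly N a z) ^ 4" for z
      by simp
    show ?thesis unfolding *
      by (subst circle_mean_add, (intro continuous_intros)+)+ (simp only: circle_mean_mult)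
  qed
  also have "circle_mean (\<lambda>z. (norm (tpoly N y z))\<^sup>2) = 1"
    using Y by (simp only: tpoly_parseval_norm)
  also have "\<delta> / 4 * 1 + 4 * \<delta> / 49 * circle_mean (\<lambda>z. norm (tpoly N a z) ^ 4)
      + D * circle_mean (\<lambda>z. sqrt (norm (tpoly N y z))) \<le> \<delta> / 4 * 1 + 4 * \<delta> / 49 * 3 + D * (8 * sqrt 2 * sqrt A)"
    unfolding y A_def using \<open>0 < \<delta>\<close> a
    by (intro add_mono mult_left_mono tpoly_half_mean T) (auto simp: D_def)
  also have "\<dots> \<le> \<delta> + 175616 / \<delta> ^ 5 * A"
  proof -
    \<comment> \<open>The other half of \<delta> is spent on the arithmetic-geometric mean
      inequality for sqrt \<delta> times p. Here 175616 = 1372 * 128, and 128 is the square of the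
      constant 8 sqrt 2 of \<open>tpoly_half_mean\<close>.\<close>
    define p where "p = sqrt (175616 / \<delta> ^ 5 * A)"
    have p2: "p\<^sup>2 = 175616 / \<delta> ^ 5 * A" using A0 \<open>0 < \<delta>\<close> by (simp add: p_def)
    have "8 * sqrt 2 = sqrt 128" using real_sqrt_mult[of 64 2] by simp
    then have "D * (8 * sqrt 2 * sqrt A) = sqrt (1372 / \<delta> ^ 4 * 128 * A)"
      unfolding D_def by (simp only: real_sqrt_mult mult.assoc)
    also have "1372 / \<delta> ^ 4 * 128 * A = \<delta> * (175616 / \<delta> ^ 5 * A)"
      using \<open>0 < \<delta>\<close> by (simp add: field_simps eval_nat_numeral)
    also have "sqrt \<dots> = sqrt \<delta> * p" by (simp only: real_sqrt_mult p_def)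
    finally have "D * (8 * sqrt 2 * sqrt A) = sqrt \<delta> * p" .
    moreover have "2 * (sqrt \<delta> * p) \<le> \<delta> + p\<^sup>2"
      using sum_squares_bound[of "sqrt \<delta>" p] \<open>0 < \<delta>\<close> by simp
    moreover have "0 \<le> p\<^sup>2" by simp
    ultimately show ?thesis using \<open>0 < \<delta>\<close> unfolding p2 by simp
  qed
  finally show ?thesis by (simp add: A_def)
qed

text \<open>Both sides are homogeneous of degree one in the pair \<open>y\<close>, \<open>g\<close>,
  so division by the l2 norm of \<open>y\<close> leads to the normalized case.\<close>

lemma pairing_bound:
  fixes a :: "nat \<Rightarrow> complex" and g :: "complex \<Rightarrow> complex"
  assumes T: "finite T" "T \<subseteq> sphere 0 1" and "0 < \<delta>"
    and a: "circle_mean (\<lambda>z. norm (tpoly N a z) ^ 4) \<le> 3"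
    and y: "\<And>j. j < N \<Longrightarrow> y j = (\<Sum>\<zeta>\<in>T. g \<zeta> * cnj \<zeta> ^ j)"
  shows "norm (\<Sum>j<N. a j * cnj (y j))
    \<le> \<delta> * sqrt (\<Sum>j<N. (norm (y j))\<^sup>2) + 175616 / \<delta> ^ 5 * (\<Sum>\<zeta>\<in>T. norm (g \<zeta>))"
proof -
  define Y where "Y = sqrt (\<Sum>j<N. (norm (y j))\<^sup>2)"
  have Y2: "Y\<^sup>2 = (\<Sum>j<N. (norm (y j))\<^sup>2)" by (simp add: Y_def sum_nonneg)
  have "0 \<le> Y" by (simp add: Y_def sum_nonneg)
  show ?thesis
  proof (cases "Y = 0")
    case True
    then have "\<forall>j<N. y j = 0" using Y2 by (simp add: sum_nonneg_eq_0_iff)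
    then show ?thesis using \<open>0 < \<delta>\<close> by (simp add: sum_nonneg)
  next
    case False
    then have "0 < Y" using \<open>0 \<le> Y\<close> by simp
    have div: "(\<Sum>\<zeta>\<in>T. g \<zeta> / Y * cnj \<zeta> ^ j) = (\<Sum>\<zeta>\<in>T. g \<zeta> * cnj \<zeta> ^ j) / Y" for j
      by (simp add: sum_divide_distrib)
    have "norm (\<Sum>j<N. a j * cnj (\<Sum>\<zeta>\<in>T. (g \<zeta> / Y) * cnj \<zeta> ^ j))
        \<le> \<delta> + 175616 / \<delta> ^ 5 * (\<Sum>\<zeta>\<in>T. norm (g \<zeta> / Y))"
    proof (rule pairing_bound_normalized[OF T \<open>0 < \<delta>\<close> a])
      have "(\<Sum>j<N. (norm (\<Sum>\<zeta>\<in>T. g \<zeta> / Y * cnj \<zeta> ^ j))\<^sup>2) = (\<Sum>j<N. (norm (y j))\<^sup>2 / Y\<^sup>2)"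
        unfolding div by (intro sum.cong) (simp_all add: y norm_divide power_divide)
      also have "\<dots> = 1" using \<open>0 < Y\<close> by (simp flip: sum_divide_distrib Y2)
      finally show "(\<Sum>j<N. (norm (\<Sum>\<zeta>\<in>T. g \<zeta> / Y * cnj \<zeta> ^ j))\<^sup>2) = 1" .
    qed simp
    also have "(\<Sum>j<N. a j * cnj (\<Sum>\<zeta>\<in>T. (g \<zeta> / Y) * cnj \<zeta> ^ j)) = (\<Sum>j<N. a j * cnj (y j)) / Y"
      unfolding div sum_divide_distrib[of _ "{..<N}"] by (intro sum.cong) (simp_all add: y)
    also have "(\<Sum>\<zeta>\<in>T. norm (g \<zeta> / Y)) = (\<Sum>\<zeta>\<in>T. norm (g \<zeta>)) / Y"
      using \<open>0 < Y\<close> by (simp add: norm_divide sum_divide_distrib)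
    finally show ?thesis using \<open>0 < Y\<close> unfolding Y_def[symmetric]
      by (simp add: norm_divide field_simps)
  qed
qed

section \<open>Penalized least squares and approximation by bounded polynomials\<close>

lemma closest_point_cball_inner:
  fixes w :: complex
  assumes "0 \<le> r"
  defines "p \<equiv> closest_point (cball 0 r) w"
  shows "r * norm (w - p) \<le> inner (w - p) w"
proof -
  let ?g = "w - p"
  \<comment> \<open>The variational inequality of the projection is tested with the point of the
    disc that maximizes the inner product with \<open>?g\<close>.\<close>
  have "inner ?g (of_real r * sgn ?g - p) \<le> 0"
    unfolding p_def by (rule closest_point_dot) (use assms in \<open>auto simp: norm_mult norm_sgn\<close>)
  moreover have "inner ?g (of_real r * sgn ?g) = r * norm ?g"
  proof -
    have "inner ?g (of_real r * sgn ?g) = r * (inner ?g ?g / norm ?g)"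
      by (simp add: sgn_div_norm scaleR_conv_of_real[symmetric] divide_inverse)
    also have "inner ?g ?g / norm ?g = norm ?g"
      by (simp add: power2_eq_square flip: power2_norm_eq_inner)
    finally show ?thesis .
  qed
  moreover have "inner ?g w = inner ?g ?g + inner ?g p"
    by (simp flip: inner_add_right)
  ultimately show ?thesis
    using inner_ge_zero[of ?g] by (simp add: inner_diff_right)
qed

text \<open>\<open>G\<close> minimizes the squared distance to \<open>a\<close> plus the squared
  distances of its values on \<open>T\<close> to the disc of radius \<kappa>, and \<open>g\<close>
  is the displacement from that disc. The four conclusions come from stationarity, the projection
  inequality, comparison with the zero polynomial, and the box in which \<open>G\<close> is
  sought.\<close>

lemma penalized_minimizer:
  fixes a :: "nat \<Rightarrow> complex"
  assumes T: "finite T" "T \<subseteq> sphere 0 1" and "0 \<le> \<kappa>"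
  shows "\<exists>G g. (\<forall>j<N. a j - G j = (\<Sum>\<zeta>\<in>T. g \<zeta> * cnj \<zeta> ^ j)) \<and>
    (\<forall>\<zeta>\<in>T. \<kappa> * norm (g \<zeta>) \<le> inner (g \<zeta>) (tpoly N G \<zeta>)) \<and>
    (\<forall>\<zeta>\<in>T. norm (tpoly N G \<zeta>) \<le> \<kappa> + sqrt (\<Sum>j<N. (norm (a j))\<^sup>2)) \<and>
    (\<forall>j<N. norm (G j) \<le> 2 * sqrt (\<Sum>j<N. (norm (a j))\<^sup>2))"
proof -
  define W where "W = closest_point (cball (0::complex) \<kappa>)"
  define \<Phi> where "\<Phi> H = (\<Sum>j<N. (norm (a j - H j))\<^sup>2)
      + (\<Sum>\<zeta>\<in>T. (norm (tpoly N H \<zeta> - W (tpoly N H \<zeta>)))\<^sup>2)" for H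
  define R where "R = sqrt (\<Sum>j<N. (norm (a j))\<^sup>2)"
  have R0: "0 \<le> R" and R2: "R\<^sup>2 = (\<Sum>j<N. (norm (a j))\<^sup>2)" by (simp_all add: R_def sum_nonneg)
  have aR: "norm (a j) \<le> R" if "j < N" for j
  proof -
    have "(norm (a j))\<^sup>2 \<le> R\<^sup>2" unfolding R2 using that by (intro member_le_sum) auto
    then show ?thesis using R0 by (rule power2_le_imp_le)
  qed
  have Wle: "norm (w - W w) \<le> norm (w - x)" if "norm x \<le> \<kappa>" for w x
    using closest_point_le[of "cball 0 \<kappa>" x w] that by (simp add: W_def dist_norm)
  have Wn: "norm (W w) \<le> \<kappa>" for w
    using closest_point_in_set[of "cball 0 \<kappa>" w] \<open>0 \<le> \<kappa>\<close> by (simp add: W_def)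
  have W0: "W 0 = 0" using Wle[of 0 0] \<open>0 \<le> \<kappa>\<close> by simp
  have cW: "continuous_on A W" for A
    unfolding W_def by (rule continuous_on_closest_point) (use \<open>0 \<le> \<kappa>\<close> in auto)
  \<comment> \<open>Coordinates from \<open>N\<close> on are pinned to 0, and Tychonoff's theorem
    makes this set compact. The radius \<open>2 * R\<close> makes a minimizer on \<open>S\<close>
    global: any larger coefficient alone already costs R^2, the value of \<Phi> at 0.\<close>
  define S where "S = (PiE UNIV (\<lambda>j. if j < N then cball 0 (2 * R) else {0}) :: (nat \<Rightarrow> complex) set)"
  have "compact S"
    using compactin_PiE[of "\<lambda>_. euclidean" UNIV "\<lambda>j. if j < N then cball 0 (2 * R) else {0::complex}"]
    by (simp add: S_def euclidean_product_topology)
  moreover have zero: "(\<lambda>_. 0) \<in> S" using R0 by (auto simp: S_def)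
  moreover have "continuous_on S \<Phi>"
  proof -
    have c: "continuous_on S (\<lambda>H. H j)" for j
      by (rule continuous_on_subset[OF continuous_on_product_coordinates]) auto
    have "continuous_on S (\<lambda>H. W (tpoly N H \<zeta>))" for \<zeta>
      by (rule continuous_on_compose2[OF cW[of UNIV]]) (intro continuous_intros c, auto)
    then show ?thesis unfolding \<Phi>_def by (intro continuous_intros c)
  qed
  ultimately obtain G where "G \<in> S" and min: "\<And>H. H \<in> S \<Longrightarrow> \<Phi> G \<le> \<Phi> H"
    using continuous_attains_inf[of S \<Phi>] by blast
  have \<Phi>0: "\<Phi> (\<lambda>_. 0) = R\<^sup>2" by (simp add: \<Phi>_def R2 W0)
  have glob: "\<Phi> G \<le> \<Phi> H" for H
  proof (cases "\<forall>j<N. norm (H j) \<le> 2 * R")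
    case True
    define H' where "H' j = (if j < N then H j else 0)" for j
    have "H' \<in> S" using True by (auto simp: S_def H'_def)
    moreover have "\<Phi> H' = \<Phi> H" by (simp add: \<Phi>_def H'_def)
    ultimately show ?thesis using min by metis
  next
    case False
    then obtain j where j: "j < N" "2 * R < norm (H j)" by auto
    have "R \<le> norm (a j - H j)"
      using norm_triangle_ineq2[of "H j" "a j"] aR[OF j(1)] j(2) by (simp add: norm_minus_commute)
    then have "R\<^sup>2 \<le> (norm (a j - H j))\<^sup>2" using R0 by (intro power_mono) auto
    also have "\<dots> \<le> (\<Sum>j<N. (norm (a j - H j))\<^sup>2)" using j(1) by (intro member_le_sum) auto
    also have "\<dots> \<le> \<Phi> H" by (simp add: \<Phi>_def sum_nonneg)
    finally show ?thesis using min[OF zero] \<Phi>0 by linarith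
  qed
  define g where "g \<zeta> = tpoly N G \<zeta> - W (tpoly N G \<zeta>)" for \<zeta>
  show ?thesis
  proof (intro exI[of _ G] exI[of _ g] conjI allI ballI impI)
    fix j assume j: "j < N"
    define E where "E = a j - G j - (\<Sum>\<zeta>\<in>T. g \<zeta> * cnj \<zeta> ^ j)"
    define M where "M = 1 + real (card T)"
    have "1 \<le> M" by (simp add: M_def)
    \<comment> \<open>Stationarity without differentiating the projection: when the coefficient j
      moves by h, the new distances are estimated with the foot points of the old values. The
      resulting majorant of \<Phi> is quadratic in h and is attained at h = 0.\<close>
    have var: "2 * inner E h \<le> M * (norm h)\<^sup>2" for h
    proof -
      define H where "H = G(j := G j + h)"
      have poly: "tpoly N H z = tpoly N G z + h * z ^ j" for z
      proof -
        have "tpoly N H z = (\<Sum>i<N. G i * z ^ i + (if i = j then h * z ^ j else 0))"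
          by (intro sum.cong) (auto simp: H_def ring_distribs)
        then show ?thesis using j by (simp add: sum.distrib)
      qed
      have "(\<Sum>i<N. (norm (a i - H i))\<^sup>2)
          = (\<Sum>i<N. (norm (a i - G i))\<^sup>2 + (if i = j then (norm h)\<^sup>2 - 2 * inner (a j - G j) h else 0))"
        by (intro sum.cong)
           (auto simp: H_def power2_norm_eq_inner inner_diff_left inner_diff_right inner_add_left inner_add_right inner_commute)
      then have 1: "(\<Sum>i<N. (norm (a i - H i))\<^sup>2)
          = (\<Sum>i<N. (norm (a i - G i))\<^sup>2) + ((norm h)\<^sup>2 - 2 * inner (a j - G j) h)"
        using j by (simp add: sum.distrib)
      have 2: "(norm (tpoly N H \<zeta> - W (tpoly N H \<zeta>)))\<^sup>2
          \<le> (norm (g \<zeta>))\<^sup>2 + (2 * inner (g \<zeta> * cnj \<zeta> ^ j) h + (norm h)\<^sup>2)" if "\<zeta> \<in> T" for \<zeta>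
      proof -
        have n: "norm (h * \<zeta> ^ j) = norm h" using that T by (auto simp: norm_mult norm_power)
        have i: "inner (g \<zeta>) (h * \<zeta> ^ j) = inner (g \<zeta> * cnj \<zeta> ^ j) h"
          unfolding inner_complex_def by (simp add: algebra_simps flip: complex_cnj_power)
        have "norm (tpoly N H \<zeta> - W (tpoly N H \<zeta>)) \<le> norm (tpoly N H \<zeta> - W (tpoly N G \<zeta>))"
          by (rule Wle[OF Wn])
        also have "tpoly N H \<zeta> - W (tpoly N G \<zeta>) = g \<zeta> + h * \<zeta> ^ j"
          by (simp add: poly g_def)
        finally have "(norm (tpoly N H \<zeta> - W (tpoly N H \<zeta>)))\<^sup>2 \<le> (norm (g \<zeta> + h * \<zeta> ^ j))\<^sup>2"
          by (intro power_mono) auto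
        also have "\<dots> = (norm (g \<zeta>))\<^sup>2 + 2 * inner (g \<zeta>) (h * \<zeta> ^ j) + (norm (h * \<zeta> ^ j))\<^sup>2"
          unfolding power2_norm_eq_inner by (simp add: inner_add_left inner_add_right inner_commute)
        finally show ?thesis by (simp add: n i)
      qed
      have "\<Phi> G \<le> \<Phi> H" by (rule glob)
      also have "\<dots> \<le> (\<Sum>i<N. (norm (a i - H i))\<^sup>2)
          + (\<Sum>\<zeta>\<in>T. (norm (g \<zeta>))\<^sup>2 + (2 * inner (g \<zeta> * cnj \<zeta> ^ j) h + (norm h)\<^sup>2))"
        unfolding \<Phi>_def by (intro add_left_mono sum_mono 2)
      also have "\<dots> = \<Phi> G + ((norm h)\<^sup>2 - 2 * inner (a j - G j) h
          + (2 * inner (\<Sum>\<zeta>\<in>T. g \<zeta> * cnj \<zeta> ^ j) h + card T * (norm h)\<^sup>2))"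
        unfolding 1 \<Phi>_def by (simp add: g_def sum.distrib inner_sum_left sum_distrib_left)
      finally have "2 * inner (a j - G j) h - 2 * inner (\<Sum>\<zeta>\<in>T. g \<zeta> * cnj \<zeta> ^ j) h
          \<le> (norm h)\<^sup>2 + card T * (norm h)\<^sup>2" by linarith
      then show ?thesis unfolding E_def M_def inner_diff_left[of "a j - G j"] distrib_right by simp
    qed
    \<comment> \<open>The test vector h = E / M makes the linear term twice the quadratic one, which
      leaves only E = 0.\<close>
    have "2 * ((norm E)\<^sup>2 / M) \<le> (norm E)\<^sup>2 / M"
      using var[of "E /\<^sub>R M"] \<open>1 \<le> M\<close>
      by (simp add: dot_square_norm power_mult_distrib power2_eq_square field_simps)
    moreover have "0 \<le> (norm E)\<^sup>2 / M" using \<open>1 \<le> M\<close> by simp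
    ultimately have "(norm E)\<^sup>2 / M = 0" by linarith
    then have "E = 0" using \<open>1 \<le> M\<close> by simp
    then show "a j - G j = (\<Sum>\<zeta>\<in>T. g \<zeta> * cnj \<zeta> ^ j)" by (simp add: E_def)
  next
    fix \<zeta>
    show "\<kappa> * norm (g \<zeta>) \<le> inner (g \<zeta>) (tpoly N G \<zeta>)"
      unfolding g_def W_def by (rule closest_point_cball_inner[OF \<open>0 \<le> \<kappa>\<close>])
  next
    fix \<zeta> assume "\<zeta> \<in> T"
    have "(norm (g \<zeta>))\<^sup>2 \<le> (\<Sum>\<zeta>\<in>T. (norm (g \<zeta>))\<^sup>2)" using \<open>\<zeta> \<in> T\<close> T by (intro member_le_sum) auto
    also have "\<dots> \<le> \<Phi> G" by (simp add: \<Phi>_def g_def sum_nonneg)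
    also have "\<dots> \<le> R\<^sup>2" using glob[of "\<lambda>_. 0"] \<Phi>0 by simp
    finally have "norm (g \<zeta>) \<le> R" using R0 by (rule power2_le_imp_le)
    then show "norm (tpoly N G \<zeta>) \<le> \<kappa> + sqrt (\<Sum>j<N. (norm (a j))\<^sup>2)"
      using Wn[of "tpoly N G \<zeta>"] norm_triangle_ineq[of "W (tpoly N G \<zeta>)" "g \<zeta>"]
      by (simp add: g_def R_def)
  next
    fix j assume "j < N"
    then show "norm (G j) \<le> 2 * sqrt (\<Sum>j<N. (norm (a j))\<^sup>2)"
      using PiE_mem[of G UNIV "\<lambda>j. if j < N then cball 0 (2 * R) else {0}" j] \<open>G \<in> S\<close>
      by (simp add: S_def R_def)
  qed
qed

lemma unit_circle_finite_net:
  assumes "0 < \<eta>"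
  shows "\<exists>T. finite T \<and> T \<subseteq> sphere (0::complex) 1 \<and> (\<forall>z. norm z = 1 \<longrightarrow> (\<exists>\<zeta>\<in>T. norm (z - \<zeta>) < \<eta>))"
proof -
  obtain T where T: "finite T" "T \<subseteq> sphere (0::complex) 1" "sphere 0 1 \<subseteq> (\<Union>x\<in>T. ball x \<eta>)"
    using seq_compact_imp_totally_bounded[OF compact_imp_seq_compact[OF compact_sphere[of "0::complex" 1]], rule_format, OF assms]
    by blast
  have "\<exists>\<zeta>\<in>T. norm (z - \<zeta>) < \<eta>" if "norm z = 1" for z
    using subsetD[OF T(3), of z] that by (auto simp: dist_norm norm_minus_commute)
  with T show ?thesis by blast
qed

lemma tpoly_lipschitz:
  assumes "norm z = 1" "norm w = 1" and "\<And>j. j < N \<Longrightarrow> norm (G j) \<le> B"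
  shows "norm (tpoly N G z - tpoly N G w) \<le> B * real N ^ 2 * norm (z - w)"
proof -
  have "norm (tpoly N G z - tpoly N G w) = norm (\<Sum>j<N. G j * (z ^ j - w ^ j))"
    by (simp add: sum_subtractf right_diff_distrib)
  also have "\<dots> \<le> (\<Sum>j<N. B * (real N * norm (z - w)))"
  proof (rule sum_norm_le)
    fix j assume "j \<in> {..<N}"
    then have j: "j < N" by simp
    have "norm (z ^ j - w ^ j) \<le> real j * norm (z - w)"
      using norm_power_diff[of z w j] assms by simp
    also have "\<dots> \<le> real N * norm (z - w)" using j by (intro mult_right_mono) auto
    finally show "norm (G j * (z ^ j - w ^ j)) \<le> B * (real N * norm (z - w))"
      unfolding norm_mult using assms(3)[OF j] by (intro mult_mono) (auto intro: order_trans[OF norm_ge_zero])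
  qed
  finally show ?thesis by (simp add: power2_eq_square mult_ac)
qed

text \<open>
  Let \<open>y = F - G\<close> with \<open>G\<close> and \<open>g\<close> as in \<open>penalized_minimizer\<close>. Pairing \<open>y\<close> with \<open>G\<close> gives at least
  \<open>\<kappa> \<parallel>g\<parallel>\<close>, which absorbs the second term of \<open>pairing_bound\<close>, so \<open>\<parallel>y\<parallel>\<^sup>2 \<le> \<delta> \<parallel>y\<parallel>\<close>.
\<close>
lemma bounded_sign_approximation:
  fixes c :: "nat \<Rightarrow> complex"
  assumes "0 < \<delta>" and \<kappa>: "1 \<le> \<kappa>" "175616 / \<delta> ^ 5 \<le> \<kappa>" and c: "(\<Sum>j<N. (norm (c j))\<^sup>2) \<le> 1"
  shows "\<exists>(\<epsilon> :: nat \<Rightarrow> real) G. (\<forall>j. \<bar>\<epsilon> j\<bar> = (1::real)) \<and>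
    (\<Sum>j<N. (norm (\<epsilon> j * c j - G j))\<^sup>2) \<le> \<delta>\<^sup>2 \<and>
    (\<forall>z. norm z = 1 \<longrightarrow> norm (tpoly N G z) \<le> 3 * \<kappa>)"
proof -
  obtain \<epsilon> :: "nat \<Rightarrow> real" where \<epsilon>: "\<And>j. \<bar>\<epsilon> j\<bar> = 1" and
    le: "circle_mean (\<lambda>z. norm (tpoly N (\<lambda>j. \<epsilon> j * c j) z) ^ 4) \<le> 3 * (\<Sum>j<N. (norm (c j))\<^sup>2)\<^sup>2"
    using fourth_power_sign_choice by blast
  define a where "a j = \<epsilon> j * c j" for j
  have sa: "(\<Sum>j<N. (norm (a j))\<^sup>2) = (\<Sum>j<N. (norm (c j))\<^sup>2)" by (simp add: a_def norm_mult \<epsilon>)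
  have "(\<Sum>j<N. (norm (c j))\<^sup>2)\<^sup>2 \<le> 1" using c by (simp add: power_le_one sum_nonneg)
  then have m4: "circle_mean (\<lambda>z. norm (tpoly N a z) ^ 4) \<le> 3" using le by (simp add: a_def)
  define q where "q = real N ^ 2 + 1"
  have q: "0 < q" "real N ^ 2 \<le> q" unfolding q_def by (rule add_nonneg_pos) simp_all
  \<comment> \<open>Coefficients bounded by \<open>2 * \<kappa>\<close> give a Lipschitz constant
    for which this mesh changes values by at most \<kappa>; the bound \<kappa> + 1 on the net thus
    becomes 3 \<kappa> on the circle. The size of the net depends on \<open>N\<close> but enters no
    estimate.\<close>
  define \<eta> where "\<eta> = 1 / (2 * q)"
  have "0 < \<eta>" using q by (simp add: \<eta>_def)
  obtain T where T: "finite T" "T \<subseteq> sphere (0::complex) 1"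
    and net: "\<And>z. norm z = 1 \<Longrightarrow> \<exists>\<zeta>\<in>T. norm (z - \<zeta>) < \<eta>"
    using unit_circle_finite_net[OF \<open>0 < \<eta>\<close>] by blast
  obtain G g where G: "\<And>j. j < N \<Longrightarrow> a j - G j = (\<Sum>\<zeta>\<in>T. g \<zeta> * cnj \<zeta> ^ j)"
    and gin: "\<And>\<zeta>. \<zeta> \<in> T \<Longrightarrow> \<kappa> * norm (g \<zeta>) \<le> inner (g \<zeta>) (tpoly N G \<zeta>)"
    and Gle: "\<And>\<zeta>. \<zeta> \<in> T \<Longrightarrow> norm (tpoly N G \<zeta>) \<le> \<kappa> + sqrt (\<Sum>j<N. (norm (a j))\<^sup>2)"
    and Gj: "\<And>j. j < N \<Longrightarrow> norm (G j) \<le> 2 * sqrt (\<Sum>j<N. (norm (a j))\<^sup>2)"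
  proof -
    have "0 \<le> \<kappa>" using \<kappa>(1) by simp
    from penalized_minimizer[OF T this, where N = N and a = a]
    obtain G g where "\<forall>j<N. a j - G j = (\<Sum>\<zeta>\<in>T. g \<zeta> * cnj \<zeta> ^ j)"
      "\<forall>\<zeta>\<in>T. \<kappa> * norm (g \<zeta>) \<le> inner (g \<zeta>) (tpoly N G \<zeta>)"
      "\<forall>\<zeta>\<in>T. norm (tpoly N G \<zeta>) \<le> \<kappa> + sqrt (\<Sum>j<N. (norm (a j))\<^sup>2)"
      "\<forall>j<N. norm (G j) \<le> 2 * sqrt (\<Sum>j<N. (norm (a j))\<^sup>2)"
      by (elim exE conjE)
    then show ?thesis by (intro that[of G g]) auto
  qed
  define y where "y j = a j - G j" for j
  define Y where "Y = sqrt (\<Sum>j<N. (norm (y j))\<^sup>2)"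
  define A where "A = (\<Sum>\<zeta>\<in>T. norm (g \<zeta>))"
  have Y0: "0 \<le> Y" and Y2: "Y\<^sup>2 = (\<Sum>j<N. (norm (y j))\<^sup>2)" by (simp_all add: Y_def sum_nonneg)
  have "norm (\<Sum>j<N. a j * cnj (y j)) \<le> \<delta> * Y + 175616 / \<delta> ^ 5 * A"
    unfolding Y_def A_def by (rule pairing_bound[OF T \<open>0 < \<delta>\<close> m4]) (simp add: y_def G)
  also have "\<dots> \<le> \<delta> * Y + \<kappa> * A" by (intro add_left_mono mult_right_mono \<kappa>(2)) (simp add: A_def sum_nonneg)
  finally have 1: "norm (\<Sum>j<N. a j * cnj (y j)) \<le> \<delta> * Y + \<kappa> * A" .
  have "\<kappa> * A \<le> (\<Sum>\<zeta>\<in>T. inner (g \<zeta>) (tpoly N G \<zeta>))"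
    unfolding A_def sum_distrib_left by (intro sum_mono gin)
  also have "\<dots> = (\<Sum>j<N. inner (y j) (G j))"
  proof -
    have "inner (g \<zeta>) (G j * \<zeta> ^ j) = inner (g \<zeta> * cnj \<zeta> ^ j) (G j)" for \<zeta> j
      unfolding inner_complex_def by (simp add: algebra_simps flip: complex_cnj_power)
    then have "(\<Sum>\<zeta>\<in>T. inner (g \<zeta>) (tpoly N G \<zeta>)) = (\<Sum>j<N. \<Sum>\<zeta>\<in>T. inner (g \<zeta> * cnj \<zeta> ^ j) (G j))"
      by (simp add: inner_sum_right) (rule sum.swap)
    also have "\<dots> = (\<Sum>j<N. inner (y j) (G j))"
      by (intro sum.cong) (auto simp: y_def G inner_sum_left)
    finally show ?thesis .
  qed
  finally have 2: "\<kappa> * A \<le> (\<Sum>j<N. inner (y j) (G j))" .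
  have "Y\<^sup>2 = (\<Sum>j<N. inner (y j) (a j)) - (\<Sum>j<N. inner (y j) (G j))"
    unfolding Y2 power2_norm_eq_inner by (simp add: y_def inner_diff_right sum_subtractf)
  also have "(\<Sum>j<N. inner (y j) (a j)) = Re (\<Sum>j<N. a j * cnj (y j))"
    by (simp add: inner_complex_def mult.commute)
  finally have "Y\<^sup>2 \<le> \<delta> * Y" using 1 2 complex_Re_le_cmod[of "\<Sum>j<N. a j * cnj (y j)"] by linarith
  then have "Y \<le> \<delta>" using Y0 \<open>0 < \<delta>\<close> by (cases "Y = 0") (auto simp: power2_eq_square)
  then have "Y\<^sup>2 \<le> \<delta>\<^sup>2" using Y0 by (rule power_mono)
  then have err: "(\<Sum>j<N. (norm (a j - G j))\<^sup>2) \<le> \<delta>\<^sup>2" by (simp add: Y2 y_def)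
  have s1: "sqrt (\<Sum>j<N. (norm (a j))\<^sup>2) \<le> 1" using c by (simp add: sa)
  have GB: "norm (G j) \<le> 2 * \<kappa>" if "j < N" for j
    using Gj[OF that] s1 \<kappa>(1) by linarith
  show ?thesis
  proof (intro exI[of _ \<epsilon>] exI[of _ G] conjI allI impI)
    show "\<bar>\<epsilon> j\<bar> = 1" for j by (rule \<epsilon>)
    show "(\<Sum>j<N. (norm (\<epsilon> j * c j - G j))\<^sup>2) \<le> \<delta>\<^sup>2" using err by (simp add: a_def)
    fix z :: complex assume z: "norm z = 1"
    obtain \<zeta> where \<zeta>: "\<zeta> \<in> T" "norm (z - \<zeta>) < \<eta>" using net[OF z] by blast
    have "norm (tpoly N G z - tpoly N G \<zeta>) \<le> 2 * \<kappa> * real N ^ 2 * norm (z - \<zeta>)"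
    proof (rule tpoly_lipschitz[OF z _ GB])
      show "norm \<zeta> = 1" using \<zeta>(1) T(2) by auto
    qed
    also have "\<dots> \<le> 2 * \<kappa> * real N ^ 2 * \<eta>" using \<zeta> \<kappa> by (intro mult_left_mono) auto
    also have "\<dots> = \<kappa> * (real N ^ 2 / q)" by (simp add: \<eta>_def)
    also have "\<dots> \<le> \<kappa> * 1" using \<kappa>(1) q by (intro mult_left_mono) auto
    finally have "norm (tpoly N G z - tpoly N G \<zeta>) \<le> \<kappa>" by simp
    moreover have "norm (tpoly N G \<zeta>) \<le> \<kappa> + 1"
      using Gle[OF \<zeta>(1)] s1 by linarith
    ultimately show "norm (tpoly N G z) \<le> 3 * \<kappa>"
      using norm_triangle_ineq2[of "tpoly N G z" "tpoly N G \<zeta>"] \<kappa>(1) by linarith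
  qed
qed

lemma bounded_sign_approximation_scaled:
  fixes c :: "nat \<Rightarrow> complex"
  assumes "0 < \<delta>" and \<kappa>: "1 \<le> \<kappa>" "175616 / \<delta> ^ 5 \<le> \<kappa>"
    and "0 < \<beta>" and c: "(\<Sum>j<N. (norm (c j))\<^sup>2) \<le> \<beta>\<^sup>2"
  shows "\<exists>(\<epsilon> :: nat \<Rightarrow> real) G. (\<forall>j. \<bar>\<epsilon> j\<bar> = (1::real)) \<and>
    (\<Sum>j<N. (norm (\<epsilon> j * c j - G j))\<^sup>2) \<le> (\<delta> * \<beta>)\<^sup>2 \<and>
    (\<forall>z. norm z = 1 \<longrightarrow> norm (tpoly N G z) \<le> 3 * \<kappa> * \<beta>)"
proof -
  have "(\<Sum>j<N. (norm (c j / \<beta>))\<^sup>2) = (\<Sum>j<N. (norm (c j))\<^sup>2) / \<beta>\<^sup>2"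
    using \<open>0 < \<beta>\<close> by (simp add: norm_divide power_divide sum_divide_distrib)
  also have "\<dots> \<le> 1" using c \<open>0 < \<beta>\<close> by (simp add: divide_le_eq_1)
  finally have "(\<Sum>j<N. (norm (c j / \<beta>))\<^sup>2) \<le> 1" .
  then obtain \<epsilon> :: "nat \<Rightarrow> real" and G where \<epsilon>: "\<And>j. \<bar>\<epsilon> j\<bar> = 1"
    and err: "(\<Sum>j<N. (norm (\<epsilon> j * (c j / \<beta>) - G j))\<^sup>2) \<le> \<delta>\<^sup>2"
    and G: "\<And>z. norm z = 1 \<Longrightarrow> norm (tpoly N G z) \<le> 3 * \<kappa>"
    using bounded_sign_approximation[OF \<open>0 < \<delta>\<close> \<kappa>, where N = N and c = "\<lambda>j. c j / \<beta>"] by blast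
  have "norm (\<epsilon> j * c j - \<beta> * G j) = \<beta> * norm (\<epsilon> j * (c j / \<beta>) - G j)" for j
  proof -
    have "\<epsilon> j * c j - \<beta> * G j = \<beta> * (\<epsilon> j * (c j / \<beta>) - G j)"
      using \<open>0 < \<beta>\<close> by (simp add: field_simps)
    then show ?thesis using \<open>0 < \<beta>\<close> by (simp only: norm_mult) simp
  qed
  then have "(\<Sum>j<N. (norm (\<epsilon> j * c j - \<beta> * G j))\<^sup>2) = \<beta>\<^sup>2 * (\<Sum>j<N. (norm (\<epsilon> j * (c j / \<beta>) - G j))\<^sup>2)"
    by (simp add: power_mult_distrib sum_distrib_left)
  also have "\<dots> \<le> \<beta>\<^sup>2 * \<delta>\<^sup>2" using err by (rule mult_left_mono) simp
  also have "\<dots> = (\<delta> * \<beta>)\<^sup>2" by (simp add: power_mult_distrib)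
  finally have 1: "(\<Sum>j<N. (norm (\<epsilon> j * c j - \<beta> * G j))\<^sup>2) \<le> (\<delta> * \<beta>)\<^sup>2" .
  have 2: "norm (tpoly N (\<lambda>j. \<beta> * G j) z) \<le> 3 * \<kappa> * \<beta>" if "norm z = 1" for z
  proof -
    have "norm (tpoly N (\<lambda>j. \<beta> * G j) z) = \<beta> * norm (tpoly N G z)"
      using \<open>0 < \<beta>\<close> by (simp add: norm_mult mult.assoc flip: sum_distrib_left)
    then show ?thesis using G[OF that] \<open>0 < \<beta>\<close> by simp
  qed
  show ?thesis by (intro exI[of _ \<epsilon>] exI[of _ "\<lambda>j. \<beta> * G j"]) (use \<epsilon> 1 2 in blast)
qed

section \<open>Iteration to an exact majorant\<close>

text \<open>
  The threshold decreases from \<open>2\<close> to \<open>1\<close>: an index that was good at stage \<open>k\<close> becomes bad only if the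
  approximation error there is at least \<open>2\<^sup>-\<^sup>k\<^sup>-\<^sup>1 \<bar>c j\<bar>\<close>. At a bad index, \<open>\<bar>P j\<bar> \<le> 2 \<bar>c j\<bar>\<close>, so adding
  \<open>\<plusminus>4 c j\<close> makes it good whatever the sign. With error \<open>\<delta> = 2\<^sup>-\<^sup>9\<^sup>-\<^sup>k\<close> the bad mass shrinks like \<open>64\<^sup>-\<^sup>k\<close>
  while \<open>\<kappa>\<close> grows only like \<open>\<delta>\<^sup>-\<^sup>5\<close>, that is \<open>32\<^sup>k\<close>.
\<close>
lemma polynomial_majorant_stage:
  fixes c :: "nat \<Rightarrow> complex"
  assumes c: "(\<Sum>j<N. (norm (c j))\<^sup>2) \<le> 1"
  defines "K \<equiv> 12 * 175616 * 2 ^ 45 :: real"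
  shows "\<exists>P. (\<forall>z. norm z = 1 \<longrightarrow> norm (tpoly N P z) \<le> 2 * K * (1 - (1/2) ^ k)) \<and>
    (\<Sum>j<N. if norm (P j) < (1 + (1/2) ^ k) * norm (c j) then (norm (c j))\<^sup>2 else 0) \<le> ((1/64) ^ k)\<^sup>2"
proof (induction k)
  case 0
  have "(\<Sum>j<N. if norm (0::complex) < (1 + (1/2) ^ 0) * norm (c j) then (norm (c j))\<^sup>2 else 0)
      \<le> (\<Sum>j<N. (norm (c j))\<^sup>2)" by (intro sum_mono) simp
  then show ?case using c by (intro exI[of _ "\<lambda>_. 0"]) simp
next
  case (Suc k)
  then obtain P where P: "\<And>z. norm z = 1 \<Longrightarrow> norm (tpoly N P z) \<le> 2 * K * (1 - (1/2) ^ k)"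
    and bad: "(\<Sum>j<N. if norm (P j) < (1 + (1/2) ^ k) * norm (c j) then (norm (c j))\<^sup>2 else 0) \<le> ((1/64) ^ k)\<^sup>2"
    by blast
  define h :: real where "h = (1/2) ^ k"
  have h: "0 < h" "h \<le> 1" by (simp_all add: h_def power_le_one)
  have "(1/64::real) = (1/2) ^ 6" by (simp add: power_divide)
  then have h64: "(1/64) ^ k = h ^ 6" by (simp only: h_def power_mult[symmetric] mult.commute)
  define d where "d j = (if norm (P j) < (1 + h) * norm (c j) then 4 * c j else 0)" for j
  have "(\<Sum>j<N. (norm (d j))\<^sup>2) = 16 * (\<Sum>j<N. if norm (P j) < (1 + h) * norm (c j) then (norm (c j))\<^sup>2 else 0)"
    unfolding sum_distrib_left by (intro sum.cong) (auto simp: d_def norm_mult power_mult_distrib)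
  also have "\<dots> \<le> 16 * (h ^ 6)\<^sup>2" using bad by (simp add: h64 flip: h_def)
  finally have d: "(\<Sum>j<N. (norm (d j))\<^sup>2) \<le> (4 * h ^ 6)\<^sup>2" by (simp add: power_mult_distrib)
  define \<kappa> where "\<kappa> = 175616 * 2 ^ 45 / h ^ 5"
  have \<kappa>1: "175616 / (h / 2 ^ 9) ^ 5 \<le> \<kappa>" by (simp add: \<kappa>_def power_divide)
  have \<kappa>2: "1 \<le> \<kappa>"
  proof -
    have "h ^ 5 \<le> 1" using h by (simp add: power_le_one)
    then show ?thesis using h by (simp add: \<kappa>_def)
  qed
  \<comment> \<open>The error parameter is fitted to the next stage: an index that is bad afterwards
    has error at least h/2 times \<open>norm (c j)\<close>, and 2/h * h/2^9 * 4 h^6 =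
    h^6/64.\<close>
  have hp: "0 < h / 2 ^ 9" "0 < 4 * h ^ 6" using h by simp_all
  obtain \<epsilon> :: "nat \<Rightarrow> real" and G where \<epsilon>: "\<And>j. \<bar>\<epsilon> j\<bar> = 1"
    and err: "(\<Sum>j<N. (norm (\<epsilon> j * d j - G j))\<^sup>2) \<le> (h / 2 ^ 9 * (4 * h ^ 6))\<^sup>2"
    and G: "\<And>z. norm z = 1 \<Longrightarrow> norm (tpoly N G z) \<le> 3 * \<kappa> * (4 * h ^ 6)"
    using bounded_sign_approximation_scaled[OF hp(1) \<kappa>2 \<kappa>1 hp(2) d] by blast
  define Q where "Q j = P j + G j" for j
  have small: "(norm (c j))\<^sup>2 \<le> (2 / h)\<^sup>2 * (norm (\<epsilon> j * d j - G j))\<^sup>2"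
    if "norm (Q j) < (1 + h / 2) * norm (c j)" for j
  proof -
    have "(1 + h) * norm (c j) \<le> norm (P j + \<epsilon> j * d j)"
    proof (cases "norm (P j) < (1 + h) * norm (c j)")
      case True
      have "norm (\<epsilon> j * d j) = 4 * norm (c j)" using True \<epsilon> by (simp add: d_def norm_mult)
      moreover have "(1 + h) * norm (c j) \<le> 2 * norm (c j)" using h by (intro mult_right_mono) auto
      ultimately show ?thesis
        using norm_diff_ineq[of "\<epsilon> j * d j" "P j"] True by (simp add: add.commute)
    next
      case False
      then show ?thesis by (simp add: d_def)
    qed
    also have "\<dots> \<le> norm (Q j) + norm (\<epsilon> j * d j - G j)"
      using norm_triangle_ineq[of "Q j" "\<epsilon> j * d j - G j"] by (simp add: Q_def)
    finally have "h / 2 * norm (c j) \<le> norm (\<epsilon> j * d j - G j)" using that by (simp add: algebra_simps)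
    then have "norm (c j) \<le> 2 / h * norm (\<epsilon> j * d j - G j)" using h by (simp add: field_simps)
    then have "(norm (c j))\<^sup>2 \<le> (2 / h * norm (\<epsilon> j * d j - G j))\<^sup>2" by (intro power_mono) auto
    then show ?thesis by (simp only: power_mult_distrib)
  qed
  have "(\<Sum>j<N. if norm (Q j) < (1 + h / 2) * norm (c j) then (norm (c j))\<^sup>2 else 0)
      \<le> (\<Sum>j<N. (2 / h)\<^sup>2 * (norm (\<epsilon> j * d j - G j))\<^sup>2)"
    by (intro sum_mono) (use small in simp)
  also have "\<dots> \<le> (2 / h)\<^sup>2 * (h / 2 ^ 9 * (4 * h ^ 6))\<^sup>2"
    unfolding sum_distrib_left[symmetric] using err by (intro mult_left_mono) auto
  also have "\<dots> = (h ^ 6 / 64)\<^sup>2"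
  proof -
    have "2 / h * (h / 2 ^ 9 * (4 * h ^ 6)) = h ^ 6 / 64" using h by (simp add: field_simps)
    then show ?thesis by (simp only: power_mult_distrib[symmetric])
  qed
  finally have 1: "(\<Sum>j<N. if norm (Q j) < (1 + h / 2) * norm (c j) then (norm (c j))\<^sup>2 else 0) \<le> (h ^ 6 / 64)\<^sup>2" .
  have 2: "norm (tpoly N Q z) \<le> 2 * K * (1 - h / 2)" if "norm z = 1" for z
  proof -
    have "norm (tpoly N Q z) \<le> norm (tpoly N P z) + norm (tpoly N G z)"
      using norm_triangle_ineq[of "tpoly N P z" "tpoly N G z"] by (simp add: Q_def ring_distribs sum.distrib)
    also have "\<dots> \<le> 2 * K * (1 - h) + 3 * \<kappa> * (4 * h ^ 6)"
      using P[OF that] G[OF that] by (simp flip: h_def)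
    \<comment> \<open>The factor h^-5 in \<kappa> meets the mass bound 4 h^6, so this stage costs
      only K h. The costs of all stages form a geometric series with sum 2 K.\<close>
    also have "3 * \<kappa> * (4 * h ^ 6) = K * h"
      using h by (simp add: \<kappa>_def K_def eval_nat_numeral)
    finally show ?thesis by (simp add: algebra_simps)
  qed
  show ?case
    using 1 2 by (intro exI[of _ Q]) (simp add: h64 flip: h_def)
qed

text \<open>Twice the constant \<open>K\<close> of \<open>polynomial_majorant_stage\<close>, the
  supremum of the bounds over all stages.\<close>

definition majorant_const :: real where
  "majorant_const = 24 * 175616 * 2 ^ 45"

lemma polynomial_majorant:
  fixes c :: "nat \<Rightarrow> complex"
  shows "\<exists>P. (\<forall>j<N. norm (c j) \<le> norm (P j)) \<and>
    (\<forall>z. norm z = 1 \<longrightarrow> norm (tpoly N P z) \<le> majorant_const * sqrt (\<Sum>j<N. (norm (c j))\<^sup>2))"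
proof -
  define Y where "Y = sqrt (\<Sum>j<N. (norm (c j))\<^sup>2)"
  have Y0: "0 \<le> Y" and Y2: "Y\<^sup>2 = (\<Sum>j<N. (norm (c j))\<^sup>2)" by (simp_all add: Y_def sum_nonneg)
  show ?thesis
  proof (cases "Y = 0")
    case True
    then have "\<forall>j<N. c j = 0" using Y2 by (simp add: sum_nonneg_eq_0_iff)
    then show ?thesis by (intro exI[of _ "\<lambda>_. 0"]) simp
  next
    case False
    then have "0 < Y" using Y0 by simp
    define d where "d j = c j / Y" for j
    have "(\<Sum>j<N. (norm (d j))\<^sup>2) = (\<Sum>j<N. (norm (c j))\<^sup>2) / Y\<^sup>2"
      by (simp add: d_def norm_divide power_divide sum_divide_distrib)
    then have d1: "(\<Sum>j<N. (norm (d j))\<^sup>2) \<le> 1" using \<open>0 < Y\<close> by (simp flip: Y2)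
    \<comment> \<open>There are finitely many nonzero coefficients, so at some stage the bad mass is
      below the square of each of them and no bad index is left. The stage depends on the
      coefficients, the bound does not.\<close>
    have "\<forall>\<^sub>F k in sequentially. \<forall>j\<in>{..<N}. d j \<noteq> 0 \<longrightarrow> (1/64::real) ^ k < norm (d j)"
    proof (intro eventually_ball_finite ballI)
      fix j
      have "\<forall>\<^sub>F k in sequentially. d j \<noteq> 0 \<longrightarrow> (1/64::real) ^ k < norm (d j)" if "d j \<noteq> 0"
      proof -
        have "(\<lambda>k. (1/64::real) ^ k) \<longlonglongrightarrow> 0" by (rule LIMSEQ_power_zero) simp
        then show ?thesis using order_tendstoD(2)[of _ 0 _ "norm (d j)"] that by simp
      qed
      then show "\<forall>\<^sub>F k in sequentially. d j \<noteq> 0 \<longrightarrow> (1/64::real) ^ k < norm (d j)"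
        by (cases "d j = 0") auto
    qed simp
    then obtain k where k: "\<And>j. j < N \<Longrightarrow> d j \<noteq> 0 \<Longrightarrow> (1/64::real) ^ k < norm (d j)"
      by (auto simp: eventually_sequentially)
    obtain P where P: "\<And>z. norm z = 1 \<Longrightarrow> norm (tpoly N P z) \<le> 2 * (12 * 175616 * 2 ^ 45) * (1 - (1/2) ^ k)"
      and bad: "(\<Sum>j<N. if norm (P j) < (1 + (1/2) ^ k) * norm (d j) then (norm (d j))\<^sup>2 else 0) \<le> ((1/64) ^ k)\<^sup>2"
      using polynomial_majorant_stage[OF d1, of k] by blast
    have dP: "norm (d j) \<le> norm (P j)" if "j < N" for j
    proof (rule ccontr)
      assume less: "\<not> norm (d j) \<le> norm (P j)"
      then have "d j \<noteq> 0" by auto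
      have "norm (d j) \<le> (1 + (1/2) ^ k) * norm (d j)" by (simp add: ring_distribs)
      then have "norm (P j) < (1 + (1/2) ^ k) * norm (d j)" using less by linarith
      then have "(norm (d j))\<^sup>2 = (if norm (P j) < (1 + (1/2) ^ k) * norm (d j) then (norm (d j))\<^sup>2 else 0)"
        by simp
      also have "\<dots> \<le> (\<Sum>j<N. if norm (P j) < (1 + (1/2) ^ k) * norm (d j) then (norm (d j))\<^sup>2 else 0)"
        by (rule member_le_sum) (use that in auto)
      also note bad
      finally have "norm (d j) \<le> (1/64) ^ k" by (rule power2_le_imp_le) simp
      then show False using k[OF that \<open>d j \<noteq> 0\<close>] by simp
    qed
    show ?thesis
    proof (intro exI[of _ "\<lambda>j. Y * P j"] conjI allI impI)
      fix j assume "j < N"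
      then show "norm (c j) \<le> norm (Y * P j)"
        using dP[of j] \<open>0 < Y\<close> by (simp add: d_def norm_divide norm_mult field_simps)
    next
      fix z :: complex assume z: "norm z = 1"
      have "norm (tpoly N (\<lambda>j. Y * P j) z) = Y * norm (tpoly N P z)"
        using \<open>0 < Y\<close> by (simp add: norm_mult mult.assoc flip: sum_distrib_left)
      also have "\<dots> \<le> Y * majorant_const"
      proof (rule mult_left_mono[OF _ Y0])
        have "2 * (12 * 175616 * 2 ^ 45) * (1 - (1/2) ^ k) \<le> 2 * (12 * 175616 * 2 ^ 45) * (1::real)"
          by (intro mult_left_mono) auto
        with P[OF z] have "norm (tpoly N P z) \<le> 2 * (12 * 175616 * 2 ^ 45) * (1::real)" by (rule order_trans)
        then show "norm (tpoly N P z) \<le> majorant_const" by (simp add: majorant_const_def)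
      qed
      finally show "norm (tpoly N (\<lambda>j. Y * P j) z) \<le> majorant_const * sqrt (\<Sum>j<N. (norm (c j))\<^sup>2)"
        by (simp add: Y_def mult.commute)
    qed
  qed
qed

section \<open>Growth of polynomial blocks and power series\<close>

lemma tpoly_bound_inside:
  assumes "\<And>z. norm z = 1 \<Longrightarrow> norm (tpoly N P z) \<le> B" and "norm w \<le> 1"
  shows "norm (tpoly N P w) \<le> B"
proof (rule maximum_modulus_frontier[of "tpoly N P" "cball 0 1"])
  show "norm (tpoly N P z) \<le> B" if "z \<in> frontier (cball 0 1)" for z
    using that assms(1) by (simp add: frontier_cball)
qed (use assms(2) in \<open>auto intro!: holomorphic_intros continuous_intros\<close>)

text \<open>Reversing the order of the coefficients gives a polynomial with the same supremum on the
  unit circle, and \<open>tpoly_bound_inside\<close> applies to it at 1 / w.\<close>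

lemma tpoly_bound_outside:
  assumes B: "\<And>z. norm z = 1 \<Longrightarrow> norm (tpoly N P z) \<le> B" and w: "1 \<le> norm w"
  shows "norm (tpoly N P w) \<le> norm w ^ (N - 1) * B"
proof (cases N)
  case 0
  have "0 \<le> B" using order_trans[OF norm_ge_zero B[of 1]] by simp
  with 0 show ?thesis by simp
next
  case (Suc k)
  define R where "R j = P (N - Suc j)" for j
  have rev: "tpoly N P z = z ^ k * tpoly N R (1 / z)" if "z \<noteq> 0" for z
  proof -
    have "tpoly N P z = (\<Sum>j<N. P (N - Suc j) * z ^ (N - Suc j))"
      by (rule sum.nat_diff_reindex[symmetric])
    also have "\<dots> = (\<Sum>j<N. z ^ k * (R j * (1 / z) ^ j))"
    proof (rule sum.cong[OF refl])
      fix j assume "j \<in> {..<N}"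
      then have "z ^ k = z ^ (N - Suc j) * z ^ j" using Suc by (simp flip: power_add)
      then show "P (N - Suc j) * z ^ (N - Suc j) = z ^ k * (R j * (1 / z) ^ j)"
        using that by (simp add: R_def power_divide)
    qed
    finally show ?thesis by (simp add: sum_distrib_left)
  qed
  have "norm (tpoly N R (1 / w)) \<le> B"
  proof (rule tpoly_bound_inside)
    fix z :: complex assume z: "norm z = 1"
    then have "z \<noteq> 0" by auto
    have "norm (tpoly N P (1 / z)) = norm (tpoly N R z)"
      using rev[of "1 / z"] \<open>z \<noteq> 0\<close> z by (simp add: norm_mult norm_power norm_divide)
    then show "norm (tpoly N R z) \<le> B" using B[of "1 / z"] z by (simp add: norm_divide)
  qed (use w in \<open>simp add: norm_divide divide_le_eq_1\<close>)
  moreover have "w \<noteq> 0" using w by auto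
  ultimately show ?thesis using rev[of w] Suc
    by (simp add: norm_mult norm_power mult_left_mono)
qed

lemma tpoly_coeff_bound:
  assumes "\<And>z. norm z = 1 \<Longrightarrow> norm (tpoly N P z) \<le> B" and "j < N"
  shows "norm (P j) \<le> B"
proof -
  have "0 \<le> B" using order_trans[OF norm_ge_zero assms(1)[of 1]] by simp
  have "(norm (P j))\<^sup>2 \<le> (\<Sum>j<N. (norm (P j))\<^sup>2)" using assms(2) by (intro member_le_sum) auto
  also have "\<dots> = circle_mean (\<lambda>z. (norm (tpoly N P z))\<^sup>2)" by (rule tpoly_parseval_norm[symmetric])
  also have "\<dots> \<le> circle_mean (\<lambda>z. B\<^sup>2)"
    by (rule circle_mean_mono) (auto intro!: continuous_intros power_mono assms(1))
  finally have "(norm (P j))\<^sup>2 \<le> B\<^sup>2" by simp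
  then show ?thesis using \<open>0 \<le> B\<close> by (rule power2_le_imp_le)
qed

text \<open>Scaling to the unit circle and dividing by z^p turns the block into a polynomial with
  \<open>N\<close> coefficients. Because the majorant keeps this spectrum, its growth is governed by
  the lowest exponent p inside the circle and by the highest, p + N - 1, outside.\<close>

lemma block_majorant:
  fixes b :: "nat \<Rightarrow> complex" and p N :: nat
  assumes "0 < R"
  defines "B \<equiv> majorant_const * sqrt (\<Sum>j\<in>{p..<p+N}. (norm (b j))\<^sup>2 * R ^ (2 * j))"
  shows "\<exists>q :: nat \<Rightarrow> complex. (\<forall>j\<in>{p..<p+N}. norm (b j) \<le> norm (q j)) \<and>
    (\<forall>z. norm z \<le> R \<longrightarrow> norm (\<Sum>j\<in>{p..<p+N}. q j * z ^ j) \<le> (norm z / R) ^ p * B) \<and>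
    (\<forall>z. R \<le> norm z \<longrightarrow> norm (\<Sum>j\<in>{p..<p+N}. q j * z ^ j) \<le> (norm z / R) ^ (p + N - 1) * B)"
proof -
  define c where "c i = b (p + i) * R ^ (p + i)" for i
  have "(\<Sum>j\<in>{p..<p+N}. (norm (b j))\<^sup>2 * R ^ (2 * j)) = (\<Sum>i<N. (norm (c i))\<^sup>2)"
    unfolding sum.atLeastLessThan_shift_0[of _ p] using \<open>0 < R\<close>
    by (simp add: c_def norm_mult norm_power power_mult_distrib atLeast0LessThan flip: power_mult)
       (simp add: mult.commute)
  then have "B = majorant_const * sqrt (\<Sum>i<N. (norm (c i))\<^sup>2)" by (simp add: B_def)
  then obtain P where P: "\<And>i. i < N \<Longrightarrow> norm (c i) \<le> norm (P i)"
    and PB: "\<And>z. norm z = 1 \<Longrightarrow> norm (tpoly N P z) \<le> B"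
    using polynomial_majorant[where c = c and N = N] by auto
  have "0 \<le> B" using order_trans[OF norm_ge_zero PB[of 1]] by simp
  define q where "q j = P (j - p) / R ^ j" for j
  have sumq: "(\<Sum>j\<in>{p..<p+N}. q j * z ^ j) = (z / R) ^ p * tpoly N P (z / R)" for z :: complex
    unfolding sum.atLeastLessThan_shift_0[of _ p] sum_distrib_left
    by (simp add: q_def power_divide power_add atLeast0LessThan field_simps)
  show ?thesis
  proof (intro exI[of _ q] conjI allI impI ballI)
    fix j assume j: "j \<in> {p..<p+N}"
    then have "norm (c (j - p)) \<le> norm (P (j - p))" by (intro P) auto
    then have "norm (b j) * R ^ j \<le> norm (P (j - p))"
      using j \<open>0 < R\<close> by (simp add: c_def norm_mult norm_power)
    moreover have "norm (q j) = norm (P (j - p)) / R ^ j"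
      using \<open>0 < R\<close> by (simp add: q_def norm_divide norm_power)
    ultimately show "norm (b j) \<le> norm (q j)" using \<open>0 < R\<close> by (simp add: pos_le_divide_eq)
  next
    fix z :: complex assume "norm z \<le> R"
    then have "norm (tpoly N P (z / R)) \<le> B"
      using \<open>0 < R\<close> by (intro tpoly_bound_inside[OF PB]) (auto simp: norm_divide)
    then show "norm (\<Sum>j\<in>{p..<p+N}. q j * z ^ j) \<le> (norm z / R) ^ p * B"
      using \<open>0 < R\<close> unfolding sumq by (simp add: norm_mult norm_power norm_divide mult_left_mono)
  next
    fix z :: complex assume z: "R \<le> norm z"
    show "norm (\<Sum>j\<in>{p..<p+N}. q j * z ^ j) \<le> (norm z / R) ^ (p + N - 1) * B"
    proof (cases "N = 0")
      case True
      then show ?thesis using \<open>0 \<le> B\<close> \<open>0 < R\<close> by simp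
    next
      case False
      have "norm (tpoly N P (z / R)) \<le> norm (z / R) ^ (N - 1) * B"
        using \<open>0 < R\<close> z by (intro tpoly_bound_outside[OF PB]) (auto simp: norm_divide)
      then have "norm (\<Sum>j\<in>{p..<p+N}. q j * z ^ j) \<le> norm (z / R) ^ p * (norm (z / R) ^ (N - 1) * B)"
        unfolding sumq norm_mult norm_power by (rule mult_left_mono) simp
      also have "\<dots> = (norm z / R) ^ (p + N - 1) * B"
        using \<open>0 < R\<close> False by (simp add: norm_divide flip: power_add mult.assoc)
      finally show ?thesis .
    qed
  qed
qed

lemma unimodal_geometric_sum:
  fixes g \<rho> :: "nat \<Rightarrow> real"
  assumes inc: "\<And>n. 1 \<le> n \<Longrightarrow> \<rho> n < \<rho> (n + 1)"
    and g0: "\<And>n. 1 \<le> n \<Longrightarrow> 0 \<le> g n" and g1: "\<And>n. 1 \<le> n \<Longrightarrow> g n \<le> 1"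
    and down: "\<And>n. 1 \<le> n \<Longrightarrow> s \<le> \<rho> n \<Longrightarrow> 2 * g (n + 1) \<le> g n"
    and up: "\<And>n. 1 \<le> n \<Longrightarrow> \<rho> (n + 1) \<le> s \<Longrightarrow> 2 * g n \<le> g (n + 1)"
  shows "(\<Sum>n=1..X. g n) \<le> 4"
proof (cases X)
  case (Suc Y)
  \<comment> \<open>Two-phase invariant. While the radii are at most s the terms at least double,
    and the last one controls the sum. At the crossing, 2 g n + g (n + 1) is at most 4 - g (n + 1)
    because no term exceeds 1. Afterwards the terms at least halve, which preserves the second
    bound.\<close>
  have "(\<rho> (Suc Y) \<le> s \<and> (\<Sum>n=1..Suc Y. g n) \<le> 2 * g (Suc Y)) \<or>
      (s < \<rho> (Suc Y) \<and> (\<Sum>n=1..Suc Y. g n) \<le> 4 - g (Suc Y))"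
  proof (induction Y)
    case 0
    then show ?case using g0[of 1] g1[of 1] by (cases "\<rho> (Suc 0) \<le> s") auto
  next
    case (Suc Y)
    then show ?case
      using g0[of "Suc Y"] g1[of "Suc Y"] g0[of "Suc (Suc Y)"] g1[of "Suc (Suc Y)"]
        inc[of "Suc Y"] down[of "Suc Y"] up[of "Suc Y"] by (cases "\<rho> (Suc (Suc Y)) \<le> s") auto
  qed
  then show ?thesis using g0[of "Suc Y"] g1[of "Suc Y"] Suc by auto
qed simp

section \<open>Entire functions and their Taylor coefficients\<close>

lemma power_series_bessel:
  fixes a :: "nat \<Rightarrow> complex"
  assumes f: "\<And>z. (\<lambda>j. a j * z ^ j) sums f z" and "0 \<le> R"
    and B: "\<And>z. norm z = R \<Longrightarrow> norm (f z) \<le> B" and "finite J"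
  shows "(\<Sum>j\<in>J. (norm (a j))\<^sup>2 * R ^ (2 * j)) \<le> B\<^sup>2"
proof -
  define c where "c j = a j * R ^ j" for j
  obtain N0 where N0: "J \<subseteq> {..<N0}" using finite_nat_iff_bounded \<open>finite J\<close> by blast
  have "0 \<le> B" using order_trans[OF norm_ge_zero B[of "of_real R"]] \<open>0 \<le> R\<close> by simp
  \<comment> \<open>Convergence at the larger radius \<open>R + 1\<close> gives absolute convergence
    on the circle of radius \<open>R\<close>, hence uniform convergence of the partial sums
    there.\<close>
  have "summable (\<lambda>j. norm (a j * of_real R ^ j))"
    by (rule powser_insidea[of a "of_real (R + 1)"]) (use f \<open>0 \<le> R\<close> in \<open>auto simp: sums_iff simp del: of_real_add\<close>)
  then have sm: "summable (\<lambda>j. norm (c j))" by (simp add: c_def)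
  have "f (R * z) = (\<Sum>j. c j * z ^ j)" for z :: complex
    using sums_unique[OF f[of "R * z"]] by (simp add: c_def power_mult_distrib mult_ac)
  moreover have "uniform_limit (sphere (0::complex) 1) (\<lambda>n z. \<Sum>j<n. c j * z ^ j) (\<lambda>z. \<Sum>j. c j * z ^ j) sequentially"
    by (rule Weierstrass_m_test[OF _ sm]) (simp add: norm_mult norm_power)
  ultimately have unif: "uniform_limit (sphere 0 1) (\<lambda>n z. \<Sum>j<n. c j * z ^ j) (\<lambda>z::complex. f (R * z)) sequentially"
    by simp
  \<comment> \<open>Parseval is applied only to a partial sum that contains \<open>J\<close> and is
    uniformly e-close to \<open>f\<close>; letting e tend to 0 replaces an argument on L2
    limits.\<close>
  have "(\<Sum>j\<in>J. (norm (c j))\<^sup>2) \<le> (B + e)\<^sup>2" if "0 < e" for e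
  proof -
    have "\<forall>\<^sub>F n in sequentially. N0 \<le> n \<and> (\<forall>z\<in>sphere (0::complex) 1. dist (\<Sum>j<n. c j * z ^ j) (f (R * z)) < e)"
      using uniform_limitD[OF unif that] eventually_ge_at_top[of N0] by eventually_elim auto
    then obtain N where N: "N0 \<le> N" "\<And>z :: complex. norm z = 1 \<Longrightarrow> dist (tpoly N c z) (f (R * z)) < e"
      by (auto simp: eventually_sequentially)
    have "(\<Sum>j\<in>J. (norm (c j))\<^sup>2) \<le> (\<Sum>j<N. (norm (c j))\<^sup>2)"
      by (rule sum_mono2) (use N0 N(1) in auto)
    also have "\<dots> = circle_mean (\<lambda>z. (norm (tpoly N c z))\<^sup>2)" by (rule tpoly_parseval_norm[symmetric])
    also have "\<dots> \<le> circle_mean (\<lambda>z. (B + e)\<^sup>2)"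
    proof (rule circle_mean_mono)
      fix z :: complex assume z: "norm z = 1"
      have "norm (tpoly N c z) \<le> norm (f (R * z)) + dist (tpoly N c z) (f (R * z))"
        using norm_triangle_ineq2[of "tpoly N c z" "f (R * z)"] by (simp add: dist_norm)
      also have "\<dots> \<le> B + e"
        using B[of "R * z"] N(2)[OF z] z \<open>0 \<le> R\<close> by (simp add: norm_mult)
      finally show "(norm (tpoly N c z))\<^sup>2 \<le> (B + e)\<^sup>2" by (intro power_mono) auto
    qed (intro continuous_intros)+
    finally show ?thesis by simp
  qed
  then have "\<forall>\<^sub>F e in at_right 0. (\<Sum>j\<in>J. (norm (c j))\<^sup>2) \<le> (B + e)\<^sup>2"
    by (simp add: eventually_at_filter)
  moreover have "((\<lambda>e. (B + e)\<^sup>2) \<longlongrightarrow> (B + 0)\<^sup>2) (at_right 0)" by (intro tendsto_intros)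
  ultimately have "(\<Sum>j\<in>J. (norm (c j))\<^sup>2) \<le> (B + 0)\<^sup>2"
    by (intro tendsto_lowerbound) auto
  moreover have "(norm (c j))\<^sup>2 = (norm (a j))\<^sup>2 * R ^ (2 * j)" for j
    using \<open>0 \<le> R\<close> by (simp add: c_def norm_mult norm_power power_mult_distrib power_even_eq)
  ultimately show ?thesis by simp
qed

lemma sums_taylor_coeffs:
  assumes "f holomorphic_on UNIV"
  shows "(\<lambda>j. taylor_coeffs f j * z ^ j) sums f z"
  unfolding taylor_coeffs_def
proof (rule has_fps_expansion_imp_sums_complex[where r = \<infinity>])
  show "f has_fps_expansion fps_expansion f 0" using assms by auto
  show "f holomorphic_on eball 0 \<infinity>" using assms holomorphic_on_subset by blast
qed simp

lemma taylor_coeffs_power_series: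
  assumes "\<And>z. summable (\<lambda>j. a j * z ^ j)"
  shows "\<exists>f. f holomorphic_on UNIV \<and> taylor_coeffs f = a \<and> (\<forall>z. (\<lambda>j. a j * z ^ j) sums f z)"
proof -
  define F where "F = Abs_fps a"
  have R: "fps_conv_radius F = \<infinity>"
    unfolding fps_conv_radius_def by (rule conv_radius_inftyI'') (use assms in \<open>simp add: F_def\<close>)
  show ?thesis
  proof (intro exI[of _ "eval_fps F"] conjI allI)
    show "eval_fps F holomorphic_on UNIV" by (rule holomorphic_on_eval_fps) (simp add: R)
    have "eval_fps F has_fps_expansion F" by (rule eval_fps_has_fps_expansion) (simp add: R)
    then show "taylor_coeffs (eval_fps F) = a"
      by (simp add: taylor_coeffs_def fps_expansion_eqI F_def fun_eq_iff)
    show "(\<lambda>j. a j * z ^ j) sums eval_fps F z" for z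
      using assms by (simp add: eval_fps_def F_def summable_sums)
  qed
qed

section \<open>Assembling the blocks\<close>

locale lusky_sequence =
  fixes v :: "real \<Rightarrow> real" and r :: "real \<Rightarrow> real"
    and m :: "nat \<Rightarrow> real" and b K :: real
  assumes weight: "weight v"
    and max_points: "max_points v r"
    and m1_pos: "0 < m 1"
    and m_mono: "strict_mono_on {1..} m"
    and m_lim: "filterlim m at_top sequentially"
    and b_gt: "b > 2" and K_ge: "K \<ge> b"
    and lower: "\<And>n. n \<ge> 1 \<Longrightarrow>
           b \<le> min (A_quot v r (m n) (m (n + 1))) (B_quot v r (m n) (m (n + 1)))"
    and upper: "\<And>n. n \<ge> 1 \<Longrightarrow>
           max (A_quot v r (m n) (m (n + 1))) (B_quot v r (m n) (m (n + 1))) \<le> K"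
begin

lemma v_pos: "0 \<le> s \<Longrightarrow> 0 < v s"
  using weight by (simp add: weight_def)

lemma m_pos: "1 \<le> n \<Longrightarrow> 0 < m n"
  using m1_pos m_mono by (cases "n = 1") (force dest: strict_mono_onD[of _ _ 1 n])+

lemma m_less: "1 \<le> n \<Longrightarrow> m n < m (n + 1)"
  using m_mono by (auto dest: strict_mono_onD[of _ _ n "n + 1"])

lemma max_point:
  assumes "0 < \<mu>"
  shows "0 \<le> r \<mu>" and "0 \<le> s \<Longrightarrow> s powr \<mu> * v s \<le> r \<mu> powr \<mu> * v (r \<mu>)"
  using assms max_points by (auto simp: max_points_def is_arg_max_def not_less)

lemma r_pos:
  assumes "0 < \<mu>"
  shows "0 < r \<mu>"
proof (rule ccontr)
  assume "\<not> 0 < r \<mu>"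
  then have "r \<mu> = 0" using max_point(1)[OF assms] by simp
  \<comment> \<open>Since \<open>0 powr \<mu> = 0\<close>, a maximum at the origin would make the
    maximal value 0.\<close>
  then have "v 1 \<le> 0" using max_point(2)[OF assms, of 1] by simp
  then show False using v_pos[of 1] by simp
qed

section \<open>Geometric decay of the normalized weighted monomials\<close>

abbreviation \<rho> :: "nat \<Rightarrow> real" where "\<rho> n \<equiv> r (m n)"

text \<open>The weighted modulus of the monomial of real degree \<open>m n\<close> on the circle of
  radius s, normalized to have its maximum 1 at \<open>\<rho> n\<close>.\<close>

definition gam :: "real \<Rightarrow> nat \<Rightarrow> real" where
  "gam s n = v s * (s / \<rho> n) powr m n / v (\<rho> n)"

lemma \<rho>_pos: "1 \<le> n \<Longrightarrow> 0 < \<rho> n"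
  by (rule r_pos[OF m_pos])

text \<open>The weight cancels in the product of the two quotients, leaving the ratio of the radii
  to the positive power \<open>m (n + 1) - m n\<close>. As the product is at least 4, the ratio
  exceeds 1.\<close>

lemma \<rho>_less:
  assumes n: "1 \<le> n"
  shows "\<rho> n < \<rho> (n + 1)"
proof (rule ccontr)
  assume "\<not> \<rho> n < \<rho> (n + 1)"
  then have le: "\<rho> (n + 1) / \<rho> n \<le> 1" using \<rho>_pos[OF n] by simp
  have p: "0 < \<rho> n" "0 < \<rho> (n + 1)" "0 < v (\<rho> n)" "0 < v (\<rho> (n + 1))"
    using \<rho>_pos[of n] \<rho>_pos[of "n + 1"] n v_pos by auto
  have "2 * 2 \<le> A_quot v r (m n) (m (n + 1)) * B_quot v r (m n) (m (n + 1))"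
    by (rule mult_mono) (use lower[OF n] b_gt in auto)
  also have "\<dots> = (\<rho> n / \<rho> (n + 1)) powr m n * (\<rho> (n + 1) / \<rho> n) powr m (n + 1)"
    using p by (simp add: A_quot_def B_quot_def)
  also have "(\<rho> n / \<rho> (n + 1)) powr m n = (\<rho> (n + 1) / \<rho> n) powr (- m n)"
    using p by (simp add: powr_minus powr_divide)
  also have "\<dots> * (\<rho> (n + 1) / \<rho> n) powr m (n + 1) = (\<rho> (n + 1) / \<rho> n) powr (m (n + 1) - m n)"
    by (simp flip: powr_add)
  also have "\<dots> \<le> 1 powr (m (n + 1) - m n)"
    by (rule powr_mono2) (use p le m_less[OF n] in auto)
  finally show False by simp
qed

lemma gam_nonneg: "1 \<le> n \<Longrightarrow> 0 \<le> s \<Longrightarrow> 0 \<le> gam s n"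
  using v_pos[of s] v_pos[of "\<rho> n"] \<rho>_pos[of n] by (simp add: gam_def)

lemma gam_le_1:
  assumes "1 \<le> n" "0 \<le> s"
  shows "gam s n \<le> 1"
  using max_point(2)[OF m_pos[OF assms(1)] assms(2)] \<rho>_pos[OF assms(1)] v_pos[of "\<rho> n"] assms(2)
  by (simp add: gam_def powr_divide mult.commute)

text \<open>\<open>B_quot\<close> is the factor that moves the base radius from
  \<open>\<rho> (n + 1)\<close> to \<open>\<rho> n\<close> while the exponent stays
  \<open>m (n + 1)\<close>.\<close>

lemma gam_Suc_B_quot:
  assumes n: "1 \<le> n" and s: "0 \<le> s"
  shows "gam s (n + 1) * B_quot v r (m n) (m (n + 1)) = v s * (s / \<rho> n) powr m (n + 1) / v (\<rho> n)"
proof -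
  have p: "0 < \<rho> n" "0 < \<rho> (n + 1)" "0 < v (\<rho> n)" "0 < v (\<rho> (n + 1))"
    using \<rho>_pos[of n] \<rho>_pos[of "n + 1"] n v_pos by auto
  have "(s / \<rho> n) powr m (n + 1) = (s / \<rho> (n + 1) * (\<rho> (n + 1) / \<rho> n)) powr m (n + 1)"
    using p by simp
  also have "\<dots> = (s / \<rho> (n + 1)) powr m (n + 1) * (\<rho> (n + 1) / \<rho> n) powr m (n + 1)"
    by (rule powr_mult)
  finally show ?thesis using p by (simp add: gam_def B_quot_def)
qed

lemma gam_A_quot:
  assumes n: "1 \<le> n" and s: "0 \<le> s"
  shows "gam s n * A_quot v r (m n) (m (n + 1)) = v s * (s / \<rho> (n + 1)) powr m n / v (\<rho> (n + 1))"
proof -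
  have p: "0 < \<rho> n" "0 < \<rho> (n + 1)" "0 < v (\<rho> n)" "0 < v (\<rho> (n + 1))"
    using \<rho>_pos[of n] \<rho>_pos[of "n + 1"] n v_pos by auto
  have "(s / \<rho> (n + 1)) powr m n = (s / \<rho> n * (\<rho> n / \<rho> (n + 1))) powr m n"
    using p by simp
  also have "\<dots> = (s / \<rho> n) powr m n * (\<rho> n / \<rho> (n + 1)) powr m n"
    by (rule powr_mult)
  finally show ?thesis using p by (simp add: gam_def A_quot_def)
qed

text \<open>The change of base radius gains a factor above 2. Then both powers have base s /
  \<open>\<rho> n\<close>, at most 1, so the smaller exponent \<open>m n\<close> gives the larger
  value.\<close>

lemma gam_decreasing:
  assumes n: "1 \<le> n" and s: "0 \<le> s" "s \<le> \<rho> n"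
  shows "2 * gam s (n + 1) \<le> gam s n"
proof -
  have "2 * gam s (n + 1) \<le> gam s (n + 1) * B_quot v r (m n) (m (n + 1))"
    unfolding mult.commute[of 2]
    by (rule mult_left_mono) (use lower[OF n] b_gt gam_nonneg[of "n + 1" s] s in auto)
  also have "\<dots> = v s * (s / \<rho> n) powr m (n + 1) / v (\<rho> n)" by (rule gam_Suc_B_quot[OF n s(1)])
  also have "\<dots> \<le> gam s n" unfolding gam_def
  proof (intro divide_right_mono mult_left_mono)
    show "(s / \<rho> n) powr m (n + 1) \<le> (s / \<rho> n) powr m n"
      by (rule powr_mono') (use s \<rho>_pos[OF n] m_less[OF n] in auto)
  qed (use v_pos s \<rho>_pos[OF n] less_imp_le in auto)
  finally show ?thesis .
qed

text \<open>Mirror image of the previous estimate: the base s / \<open>\<rho> (n + 1)\<close> is at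
  least 1, and \<open>A_quot\<close> supplies the factor.\<close>

lemma gam_increasing:
  assumes n: "1 \<le> n" and s: "\<rho> (n + 1) \<le> s"
  shows "2 * gam s n \<le> gam s (n + 1)"
proof -
  have p: "0 < \<rho> (n + 1)" using \<rho>_pos[of "n + 1"] by simp
  then have s0: "0 \<le> s" using s by simp
  have "2 * gam s n \<le> gam s n * A_quot v r (m n) (m (n + 1))"
    unfolding mult.commute[of 2]
    by (rule mult_left_mono) (use lower[OF n] b_gt gam_nonneg[of n s] n s0 in auto)
  also have "\<dots> = v s * (s / \<rho> (n + 1)) powr m n / v (\<rho> (n + 1))" by (rule gam_A_quot[OF n s0])
  also have "\<dots> \<le> gam s (n + 1)" unfolding gam_def
  proof (intro divide_right_mono mult_left_mono)
    show "(s / \<rho> (n + 1)) powr m n \<le> (s / \<rho> (n + 1)) powr m (n + 1)"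
      by (rule powr_mono) (use s p m_less[OF n] in auto)
  qed (use v_pos s0 p less_imp_le in auto)
  finally show ?thesis .
qed

lemma gam_sum_le: "0 \<le> s \<Longrightarrow> (\<Sum>n=1..X. gam s n) \<le> 4"
  by (rule unimodal_geometric_sum[where \<rho> = \<rho> and s = s])
     (use \<rho>_less gam_nonneg gam_le_1 gam_decreasing gam_increasing in auto)

section \<open>Integer end points of the blocks\<close>

text \<open>The truncation in \<open>nat\<close> is harmless since \<open>m n > 0\<close> for \<open>n \<ge> 1\<close>.\<close>
definition fl :: "nat \<Rightarrow> nat" where "fl n = Suc (nat \<lfloor>m n\<rfloor>)"

lemma less_fl_iff: "1 \<le> n \<Longrightarrow> j < fl n \<longleftrightarrow> real j \<le> m n"
  using m_pos[of n] by (simp add: fl_def less_Suc_eq_le le_nat_floor le_nat_iff le_floor_iff)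

lemma block_eq:
  assumes "1 \<le> n"
  shows "{j. m n < real j \<and> real j \<le> m (n + 1)} = {fl n..<fl (n + 1)}"
proof -
  have "m n < real j \<longleftrightarrow> fl n \<le> j" for j
    using less_fl_iff[OF assms, of j] by (cases "j < fl n") auto
  moreover have "real j \<le> m (n + 1) \<longleftrightarrow> j < fl (n + 1)" for j
    using less_fl_iff[of "n + 1" j] assms by simp
  ultimately show ?thesis by auto
qed

lemma fl_mono: "1 \<le> n \<Longrightarrow> n \<le> n' \<Longrightarrow> fl n \<le> fl n'"
  using m_mono by (auto simp: fl_def intro!: nat_mono floor_mono dest: strict_mono_on_leD[of _ _ n n'])

lemma fl_lim: "filterlim fl at_top sequentially"
proof (rule filterlim_at_top_mono)
  show "filterlim (\<lambda>n. nat \<lfloor>m n\<rfloor>) at_top sequentially"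
    by (intro filterlim_compose[OF filterlim_nat_sequentially] filterlim_compose[OF filterlim_floor_sequentially] m_lim)
qed (simp add: fl_def)

lemma fl_unbounded: "\<exists>n. j < fl (n + 1)"
proof -
  have "\<forall>\<^sub>F n in sequentially. j < fl n" by (rule eventually_compose_filterlim[OF eventually_gt_at_top fl_lim])
  then obtain N where "\<And>n. N \<le> n \<Longrightarrow> j < fl n" by (auto simp: eventually_sequentially)
  then show ?thesis by (intro exI[of _ N]) simp
qed

text \<open>Handles the indices up to \<open>m 1\<close>, which lie in no block. The constant term
  rests on monotonicity of \<open>v\<close>, because \<open>r\<close> provides maximum points for
  positive exponents only.\<close>

lemma weighted_polynomial_bounded:
  "\<exists>C. \<forall>z. v (norm z) * norm (tpoly N c z) \<le> C"
proof -
  have "\<exists>D. \<forall>s\<ge>0. v s * s ^ j \<le> D" for j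
  proof (cases "j = 0")
    case True
    have "v s \<le> v 0" if "0 \<le> s" for s
      using weight that by (auto simp: weight_def monotone_on_def)
    then show ?thesis using True by (intro exI[of _ "v 0"]) simp
  next
    case False
    have "v s * s ^ j \<le> r j powr j * v (r j)" if "0 \<le> s" for s
    proof (cases "s = 0")
      case True
      then show ?thesis using \<open>j \<noteq> 0\<close> max_point(1)[of j] v_pos[of "r j"] by (simp add: power_0_left)
    next
      case False
      then show ?thesis using max_point(2)[of j s] \<open>j \<noteq> 0\<close> that by (simp add: powr_realpow mult.commute)
    qed
    then show ?thesis by blast
  qed
  then obtain D where D: "\<And>j s. 0 \<le> s \<Longrightarrow> v s * s ^ j \<le> D j" by metis
  have "v (norm z) * norm (tpoly N c z) \<le> (\<Sum>j<N. norm (c j) * D j)" for z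
  proof -
    have "v (norm z) * norm (tpoly N c z) \<le> v (norm z) * (\<Sum>j<N. norm (c j) * norm z ^ j)"
      using v_pos[of "norm z"] by (intro mult_left_mono sum_norm_le) (auto simp: norm_mult norm_power)
    also have "\<dots> = (\<Sum>j<N. norm (c j) * (v (norm z) * norm z ^ j))"
      by (simp add: sum_distrib_left mult_ac)
    also have "\<dots> \<le> (\<Sum>j<N. norm (c j) * D j)"
      by (intro sum_mono mult_left_mono D) auto
    finally show ?thesis .
  qed
  then show ?thesis by blast
qed

section \<open>First inclusion: Bessel's inequality on the circles of maximum points\<close>

lemma solid_hull_bound:
  fixes c :: "nat \<Rightarrow> complex"
  assumes "f \<in> H_inf v" and c: "\<And>j. norm (c j) \<le> norm (taylor_coeffs f j)"
  shows "bdd_above ((\<lambda>n. v (\<rho> n) *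
    sqrt (\<Sum>j | m n < real j \<and> real j \<le> m (n + 1). (norm (c j))\<^sup>2 * \<rho> n ^ (2 * j))) ` {1..})"
proof -
  have hol: "f holomorphic_on UNIV" using assms(1) by (simp add: H_inf_def)
  obtain M where M: "\<And>z. v (norm z) * norm (f z) \<le> M"
    using assms(1) by (auto simp: H_inf_def bdd_above_def)
  have M0: "0 \<le> M" using order_trans[OF _ M[of 0]] v_pos[of 0] by simp
  have "v (\<rho> n) * sqrt (\<Sum>j\<in>{fl n..<fl (n + 1)}. (norm (c j))\<^sup>2 * \<rho> n ^ (2 * j)) \<le> M" if n: "1 \<le> n" for n
  proof -
    have p: "0 < \<rho> n" "0 < v (\<rho> n)" using \<rho>_pos[OF n] v_pos[of "\<rho> n"] by auto
    have "(\<Sum>j\<in>{fl n..<fl (n + 1)}. (norm (c j))\<^sup>2 * \<rho> n ^ (2 * j))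
        \<le> (\<Sum>j\<in>{fl n..<fl (n + 1)}. (norm (taylor_coeffs f j))\<^sup>2 * \<rho> n ^ (2 * j))"
      using p by (intro sum_mono mult_right_mono power_mono c) auto
    also have "\<dots> \<le> (M / v (\<rho> n))\<^sup>2"
    proof (rule power_series_bessel[OF sums_taylor_coeffs[OF hol]])
      show "norm (f z) \<le> M / v (\<rho> n)" if "norm z = \<rho> n" for z
        using M[of z] that p by (simp add: pos_le_divide_eq mult.commute)
    qed (use p in auto)
    finally have "sqrt (\<Sum>j\<in>{fl n..<fl (n + 1)}. (norm (c j))\<^sup>2 * \<rho> n ^ (2 * j)) \<le> M / v (\<rho> n)"
      using p M0 by (intro real_le_lsqrt) auto
    then show ?thesis using p by (simp add: pos_le_divide_eq mult.commute)
  qed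
  then show ?thesis
    by (intro bdd_aboveI[of _ M]) (elim imageE, simp only: atLeast_iff block_eq)
qed

section \<open>Second inclusion: gluing the block majorants\<close>

lemma block_index:
  assumes "fl 1 \<le> j"
  shows "\<exists>n\<ge>1. j \<in> {fl n..<fl (n + 1)}"
proof -
  obtain n where n: "j < fl (n + 1)" and least: "\<And>k. k < n \<Longrightarrow> \<not> j < fl (k + 1)"
    using fl_unbounded[of j] exists_least_iff[of "\<lambda>n. j < fl (n + 1)"] by blast
  have "n \<noteq> 0" using n assms by (cases n) auto
  then have "fl n \<le> j" using least[of "n - 1"] by simp
  with n \<open>n \<noteq> 0\<close> show ?thesis by (intro exI[of _ n]) auto
qed

lemma block_index_unique:
  assumes "1 \<le> n" "1 \<le> n'" "j \<in> {fl n..<fl (n + 1)}" "j \<in> {fl n'..<fl (n' + 1)}"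
  shows "n = n'"
proof (rule linorder_cases[of n n'])
  assume "n < n'"
  then show ?thesis using fl_mono[of "n + 1" n'] assms by auto
next
  assume "n' < n"
  then show ?thesis using fl_mono[of "n' + 1" n] assms by auto
qed

text \<open>Passage from integer to real exponents. Inside the circle, \<open>fl n\<close> is at
  least \<open>m n\<close> and the base at most 1, which yields \<open>gam\<close> at n. Outside,
  the top degree is at most \<open>m (n + 1)\<close>, which yields \<open>gam\<close> at n + 1 times
  \<open>B_quot\<close>; this is where the upper bound \<open>K\<close> enters.\<close>

lemma weighted_block_bound:
  fixes Q :: "complex \<Rightarrow> complex"
  assumes n: "1 \<le> n"
    and inside: "\<And>z. norm z \<le> \<rho> n \<Longrightarrow> norm (Q z) \<le> (norm z / \<rho> n) ^ fl n * B"
    and outside: "\<And>z. \<rho> n \<le> norm z \<Longrightarrow> norm (Q z) \<le> (norm z / \<rho> n) ^ (fl (n + 1) - 1) * B"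
    and B: "v (\<rho> n) * B \<le> D" and B0: "0 \<le> B"
  shows "v (norm z) * norm (Q z) \<le> D * K * (gam (norm z) n + gam (norm z) (n + 1))"
proof -
  define s where "s = norm z"
  have s: "0 \<le> s" by (simp add: s_def)
  have p: "0 < \<rho> n" "0 < v (\<rho> n)" "0 < v s" using \<rho>_pos[OF n] v_pos s by auto
  have D: "0 \<le> D" using B B0 p by (meson mult_nonneg_nonneg less_imp_le order_trans)
  have g: "0 \<le> gam s n" "0 \<le> gam s (n + 1)" using gam_nonneg n s by auto
  have K1: "1 \<le> K" using K_ge b_gt by simp
  have weighted: "v s * norm (Q z) \<le> D * (v s * x / v (\<rho> n))" if "norm (Q z) \<le> x * B" "0 \<le> x" for x
  proof -
    have "v s * norm (Q z) \<le> v s * (x * B)" using that p by (intro mult_left_mono) auto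
    also have "\<dots> = (v s * x / v (\<rho> n)) * (v (\<rho> n) * B)" using p by simp
    also have "\<dots> \<le> (v s * x / v (\<rho> n)) * D" using p that B by (intro mult_left_mono) auto
    finally show ?thesis by (simp add: mult.commute)
  qed
  show ?thesis
  proof (cases "s \<le> \<rho> n")
    case True
    have "(s / \<rho> n) ^ fl n \<le> (s / \<rho> n) powr m n"
    proof (cases "s = 0")
      case True
      then show ?thesis by (simp add: fl_def)
    next
      case False
      have "m n \<le> real (fl n)" using less_fl_iff[OF n, of "fl n"] by simp
      then have "(s / \<rho> n) powr real (fl n) \<le> (s / \<rho> n) powr m n"
        using True p s by (intro powr_mono') auto
      then show ?thesis using False p s by (simp add: powr_realpow)
    qed
    from order_trans[OF inside[OF True[unfolded s_def]], folded s_def, OF mult_right_mono[OF this B0]]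
    have "norm (Q z) \<le> (s / \<rho> n) powr m n * B" .
    from weighted[OF this] have "v s * norm (Q z) \<le> D * gam s n" by (simp add: gam_def)
    also have "\<dots> \<le> D * (K * (gam s n + gam s (n + 1)))"
      using D g K1 by (intro mult_left_mono) (auto intro: order_trans[OF _ mult_right_mono[of 1 K]])
    finally show ?thesis by (simp add: s_def mult.assoc)
  next
    case False
    \<comment> \<open>\<open>fl (n + 1)\<close> is a successor, so the subtraction is genuine and
      gives the floor of \<open>m (n + 1)\<close>.\<close>
    have "real (fl (n + 1) - 1) \<le> m (n + 1)"
      using less_fl_iff[of "n + 1" "fl (n + 1) - 1"] by (simp add: fl_def)
    then have "(s / \<rho> n) powr real (fl (n + 1) - 1) \<le> (s / \<rho> n) powr m (n + 1)"
      using False p by (intro powr_mono) auto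
    then have *: "(s / \<rho> n) ^ (fl (n + 1) - 1) \<le> (s / \<rho> n) powr m (n + 1)"
      using False p by (simp add: powr_realpow)
    have "\<rho> n \<le> norm z" using False by (simp add: s_def)
    from order_trans[OF outside[OF this], folded s_def, OF mult_right_mono[OF * B0]]
    have "norm (Q z) \<le> (s / \<rho> n) powr m (n + 1) * B" .
    from weighted[OF this] have "v s * norm (Q z) \<le> D * (gam s (n + 1) * B_quot v r (m n) (m (n + 1)))"
      unfolding gam_Suc_B_quot[OF n s] by simp
    also have "\<dots> \<le> D * (gam s (n + 1) * K)"
      using upper[OF n] D g by (intro mult_left_mono) auto
    also have "\<dots> \<le> D * (K * (gam s n + gam s (n + 1)))"
      using D g K1 by (intro mult_left_mono) (auto simp: algebra_simps)
    finally show ?thesis by (simp add: s_def mult.assoc)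
  qed
qed

text \<open>The majorant is \<open>c\<close> itself below \<open>fl 1\<close> and the block majorant
  on each block. Partial sums are taken at block ends, where they split into the head and whole
  blocks; \<open>gam_sum_le\<close> then makes the bound uniform in the number of blocks.\<close>

lemma bounded_blocks_majorant:
  fixes c :: "nat \<Rightarrow> complex"
  assumes "bdd_above ((\<lambda>n. v (\<rho> n) *
    sqrt (\<Sum>j | m n < real j \<and> real j \<le> m (n + 1). (norm (c j))\<^sup>2 * \<rho> n ^ (2 * j))) ` {1..})"
  shows "\<exists>a D. (\<forall>j. norm (c j) \<le> norm (a j)) \<and>
    (\<forall>X z. v (norm z) * norm (tpoly (fl (X + 1)) a z) \<le> D)"
proof -
  define L where "L n = sqrt (\<Sum>j\<in>{fl n..<fl (n + 1)}. (norm (c j))\<^sup>2 * \<rho> n ^ (2 * j))" for n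
  obtain M where M: "\<And>n. 1 \<le> n \<Longrightarrow> v (\<rho> n) * L n \<le> M"
  proof -
    obtain M where "\<And>x. x \<in> (\<lambda>n. v (\<rho> n) *
      sqrt (\<Sum>j | m n < real j \<and> real j \<le> m (n + 1). (norm (c j))\<^sup>2 * \<rho> n ^ (2 * j))) ` {1..} \<Longrightarrow> x \<le> M"
      using assms unfolding bdd_above_def by blast
    then have "v (\<rho> n) * L n \<le> M" if "1 \<le> n" for n
      unfolding L_def block_eq[OF that, symmetric] using that by blast
    then show ?thesis using that by blast
  qed
  define good where "good n q \<longleftrightarrow> (\<forall>j\<in>{fl n..<fl (n + 1)}. norm (c j) \<le> norm (q j)) \<and>
      (\<forall>z. v (norm z) * norm (\<Sum>j\<in>{fl n..<fl (n + 1)}. q j * z ^ j)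
         \<le> majorant_const * M * K * (gam (norm z) n + gam (norm z) (n + 1)))"
    for n and q :: "nat \<Rightarrow> complex"
  have "\<exists>q. 1 \<le> n \<longrightarrow> good n q" for n
  proof (cases "1 \<le> n")
    case n: True
    define N where "N = fl (n + 1) - fl n"
    have N: "fl (n + 1) = fl n + N" using fl_mono[of n "n + 1"] n by (simp add: N_def)
    obtain q :: "nat \<Rightarrow> complex" where q: "\<forall>j\<in>{fl n..<fl (n + 1)}. norm (c j) \<le> norm (q j)"
      and q1: "\<forall>z. norm z \<le> \<rho> n \<longrightarrow> norm (\<Sum>j\<in>{fl n..<fl (n + 1)}. q j * z ^ j)
        \<le> (norm z / \<rho> n) ^ fl n * (majorant_const * L n)"
      and q2: "\<forall>z. \<rho> n \<le> norm z \<longrightarrow> norm (\<Sum>j\<in>{fl n..<fl (n + 1)}. q j * z ^ j)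
        \<le> (norm z / \<rho> n) ^ (fl (n + 1) - 1) * (majorant_const * L n)"
      using block_majorant[OF \<rho>_pos[OF n], where p = "fl n" and N = N and b = c]
      unfolding L_def N by blast
    have "v (norm z) * norm (\<Sum>j\<in>{fl n..<fl (n + 1)}. q j * z ^ j)
         \<le> majorant_const * M * K * (gam (norm z) n + gam (norm z) (n + 1))" for z
    proof (rule weighted_block_bound[OF n, where B = "majorant_const * L n"])
      show "0 \<le> majorant_const * L n"
        using \<rho>_pos[OF n] by (auto simp: L_def majorant_const_def intro!: sum_nonneg)
      have "majorant_const * (v (\<rho> n) * L n) \<le> majorant_const * M"
        by (rule mult_left_mono[OF M[OF n]]) (simp add: majorant_const_def)
      then show "v (\<rho> n) * (majorant_const * L n) \<le> majorant_const * M" by (simp add: mult_ac)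
    qed (use q1 q2 in auto)
    then show ?thesis using q unfolding good_def by blast
  qed simp
  then obtain q where "\<And>n. 1 \<le> n \<Longrightarrow> good n (q n)" by metis
  then have q: "\<And>n j. 1 \<le> n \<Longrightarrow> j \<in> {fl n..<fl (n + 1)} \<Longrightarrow> norm (c j) \<le> norm (q n j)"
    and qb: "\<And>n z. 1 \<le> n \<Longrightarrow> v (norm z) * norm (\<Sum>j\<in>{fl n..<fl (n + 1)}. q n j * z ^ j)
         \<le> majorant_const * M * K * (gam (norm z) n + gam (norm z) (n + 1))"
    unfolding good_def by blast+
  define idx where "idx j = (SOME n. 1 \<le> n \<and> j \<in> {fl n..<fl (n + 1)})" for j
  have idx: "idx j = n" if "1 \<le> n" "j \<in> {fl n..<fl (n + 1)}" for n j
    unfolding idx_def using that block_index_unique by (intro some_equality) blast+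
  define a where "a j = (if j < fl 1 then c j else q (idx j) j)" for j
  have major: "norm (c j) \<le> norm (a j)" for j
  proof (cases "j < fl 1")
    case False
    then obtain n where "1 \<le> n" "j \<in> {fl n..<fl (n + 1)}" using block_index[of j] by auto
    then show ?thesis using q idx False by (simp add: a_def)
  qed (simp add: a_def)
  obtain C where C: "\<And>z. v (norm z) * norm (tpoly (fl 1) c z) \<le> C"
    using weighted_polynomial_bounded by blast
  have split: "tpoly (fl (X + 1)) a z = tpoly (fl 1) c z + (\<Sum>n=1..X. \<Sum>j\<in>{fl n..<fl (n + 1)}. q n j * z ^ j)" for X z
  proof (induction X)
    case 0
    show ?case by (simp add: a_def)
  next
    case (Suc X)
    have eq: "(\<Sum>j\<in>{fl (X + 1)..<fl (X + 1 + 1)}. a j * z ^ j) = (\<Sum>j\<in>{fl (X + 1)..<fl (X + 1 + 1)}. q (X + 1) j * z ^ j)"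
    proof (rule sum.cong[OF refl])
      fix j assume j: "j \<in> {fl (X + 1)..<fl (X + 1 + 1)}"
      then have "\<not> j < fl 1" using fl_mono[of 1 "X + 1"] by auto
      then show "a j * z ^ j = q (X + 1) j * z ^ j" using idx[OF _ j] by (simp add: a_def)
    qed
    have "tpoly (fl (X + 1 + 1)) a z = tpoly (fl (X + 1)) a z + (\<Sum>j\<in>{fl (X + 1)..<fl (X + 1 + 1)}. a j * z ^ j)"
      using sum.atLeastLessThan_concat[of 0 "fl (X + 1)" "fl (X + 1 + 1)" "\<lambda>j. a j * z ^ j"] fl_mono[of "X + 1" "X + 1 + 1"]
      by (simp add: atLeast0LessThan)
    then show ?case using Suc eq by simp
  qed
  \<comment> \<open>The absolute value spares a proof that \<open>M\<close> is nonnegative.\<close>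
  define E where "E = \<bar>majorant_const * M * K\<bar>"
  have "v (norm z) * norm (tpoly (fl (X + 1)) a z) \<le> C + E * 8" for X z
  proof -
    let ?Q = "\<lambda>n. \<Sum>j\<in>{fl n..<fl (n + 1)}. q n j * z ^ j"
    let ?g = "gam (norm z)"
    have v0: "0 \<le> v (norm z)" using v_pos[of "norm z"] by simp
    have "norm (tpoly (fl (X + 1)) a z) \<le> norm (tpoly (fl 1) c z) + (\<Sum>n=1..X. norm (?Q n))"
      unfolding split by (rule norm_triangle_le) (intro add_left_mono norm_sum)
    then have "v (norm z) * norm (tpoly (fl (X + 1)) a z)
        \<le> v (norm z) * (norm (tpoly (fl 1) c z) + (\<Sum>n=1..X. norm (?Q n)))"
      using v0 by (rule mult_left_mono)
    also have "\<dots> = v (norm z) * norm (tpoly (fl 1) c z) + (\<Sum>n=1..X. v (norm z) * norm (?Q n))"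
      by (simp add: distrib_left sum_distrib_left)
    also have "\<dots> \<le> C + (\<Sum>n=1..X. E * (?g n + ?g (n + 1)))"
    proof (intro add_mono C sum_mono)
      fix n assume "n \<in> {1..X}"
      then have n: "1 \<le> n" by simp
      have "majorant_const * M * K * (?g n + ?g (n + 1)) \<le> E * (?g n + ?g (n + 1))"
        unfolding E_def using gam_nonneg[of n "norm z"] gam_nonneg[of "n + 1" "norm z"] n
        by (intro mult_right_mono) auto
      then show "v (norm z) * norm (?Q n) \<le> E * (?g n + ?g (n + 1))"
        using qb[OF n, of z] by linarith
    qed
    also have "(\<Sum>n=1..X. E * (?g n + ?g (n + 1))) = E * ((\<Sum>n=1..X. ?g n) + (\<Sum>n=1..X. ?g (n + 1)))"
      by (simp add: sum_distrib_left sum.distrib distrib_left)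
    also have "\<dots> \<le> E * (4 + 4)"
    proof (intro mult_left_mono add_mono)
      show "(\<Sum>n=1..X. ?g n) \<le> 4" by (rule gam_sum_le) simp
      have "(\<Sum>n=1..X. ?g (n + 1)) = (\<Sum>n=2..X+1. ?g n)"
        using sum.shift_bounds_cl_Suc_ivl[of ?g 1 X] by (simp add: numeral_2_eq_2)
      also have "\<dots> \<le> (\<Sum>n=1..X+1. ?g n)"
        by (rule sum_mono2) (use gam_nonneg in auto)
      also have "\<dots> \<le> 4" by (rule gam_sum_le) simp
      finally show "(\<Sum>n=1..X. ?g (n + 1)) \<le> 4" .
    qed (simp add: E_def)
    finally show ?thesis by simp
  qed
  then show ?thesis using major by blast
qed

text \<open>Only a subsequence of the partial sums is controlled. It still bounds every coefficient
  on every circle, which forces convergence everywhere; the weighted bound then passes to the limit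
  along the subsequence.\<close>

lemma bounded_partial_sums_H_inf:
  assumes D: "\<And>X z. v (norm z) * norm (tpoly (fl (X + 1)) a z) \<le> D"
  shows "a \<in> taylor_coeffs ` H_inf v"
proof -
  have lim: "filterlim (\<lambda>X. fl (X + 1)) at_top sequentially"
    by (rule filterlim_compose[OF fl_lim filterlim_add_const_nat_at_top])
  \<comment> \<open>A Cauchy estimate for a controlled partial sum long enough to contain index
    j.\<close>
  have coeff: "norm (a j) * s ^ j \<le> D / v s" if s: "0 \<le> s" for j s
  proof -
    obtain X where X: "j < fl (X + 1)" using fl_unbounded by blast
    have "norm (a j * of_real s ^ j) \<le> D / v s"
    proof (rule tpoly_coeff_bound[OF _ X])
      fix z :: complex assume z: "norm z = 1"
      have "tpoly (fl (X + 1)) (\<lambda>j. a j * of_real s ^ j) z = tpoly (fl (X + 1)) a (of_real s * z)"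
        by (simp add: power_mult_distrib mult.assoc)
      then show "norm (tpoly (fl (X + 1)) (\<lambda>j. a j * of_real s ^ j) z) \<le> D / v s"
        using D[of "of_real s * z" X] v_pos[OF s] s z by (simp add: norm_mult pos_le_divide_eq mult.commute)
    qed
    then show ?thesis using s by (simp add: norm_mult norm_power)
  qed
  have "summable (\<lambda>j. a j * z ^ j)" for z
  proof (rule summable_comparison_test)
    define s where "s = norm z + 1"
    have s: "0 < s" "norm z < s" by (simp_all add: s_def add_nonneg_pos)
    show "\<exists>N. \<forall>j\<ge>N. norm (a j * z ^ j) \<le> D / v s * (norm z / s) ^ j"
    proof (intro exI allI impI)
      fix j
      have "norm (a j * z ^ j) = (norm (a j) * s ^ j) * (norm z / s) ^ j"
        using s by (simp add: norm_mult norm_power power_divide)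
      also have "\<dots> \<le> D / v s * (norm z / s) ^ j"
        using s by (intro mult_right_mono coeff) auto
      finally show "norm (a j * z ^ j) \<le> D / v s * (norm z / s) ^ j" .
    qed
    show "summable (\<lambda>j. D / v s * (norm z / s) ^ j)"
      using s by (intro summable_mult summable_geometric) auto
  qed
  then obtain f where f: "f holomorphic_on UNIV" "taylor_coeffs f = a"
    and sums: "\<And>z. (\<lambda>j. a j * z ^ j) sums f z"
    using taylor_coeffs_power_series[of a] by blast
  have "v (norm z) * norm (f z) \<le> D" for z
  proof (rule tendsto_upperbound)
    have "(\<lambda>X. tpoly (fl (X + 1)) a z) \<longlonglongrightarrow> f z"
      using sums[of z] unfolding sums_def by (rule filterlim_compose[OF _ lim])
    then show "(\<lambda>X. v (norm z) * norm (tpoly (fl (X + 1)) a z)) \<longlonglongrightarrow> v (norm z) * norm (f z)"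
      by (intro tendsto_intros)
    show "\<forall>\<^sub>F X in sequentially. v (norm z) * norm (tpoly (fl (X + 1)) a z) \<le> D"
      by (intro always_eventually allI D)
  qed simp
  then have "f \<in> H_inf v" using f(1) by (auto simp: H_inf_def intro!: bdd_aboveI)
  then show ?thesis using f(2) by blast
qed

lemma solid_hull_eq:
  "solid_hull (taylor_coeffs ` H_inf v) =
    {c :: nat \<Rightarrow> complex.
       bdd_above ((\<lambda>n. v (r (m n)) *
         sqrt (\<Sum>j | m n < real j \<and> real j \<le> m (n + 1). (norm (c j))\<^sup>2 * r (m n) ^ (2 * j))) ` {1..})}"
proof (intro set_eqI iffI CollectI)
  fix c
  assume "c \<in> solid_hull (taylor_coeffs ` H_inf v)"
  then obtain f where "f \<in> H_inf v" "\<And>j. norm (c j) \<le> norm (taylor_coeffs f j)"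
    by (auto simp: solid_hull_def)
  then show "bdd_above ((\<lambda>n. v (r (m n)) *
         sqrt (\<Sum>j | m n < real j \<and> real j \<le> m (n + 1). (norm (c j))\<^sup>2 * r (m n) ^ (2 * j))) ` {1..})"
    by (rule solid_hull_bound)
next
  fix c :: "nat \<Rightarrow> complex"
  assume "c \<in> {c. bdd_above ((\<lambda>n. v (r (m n)) *
         sqrt (\<Sum>j | m n < real j \<and> real j \<le> m (n + 1). (norm (c j))\<^sup>2 * r (m n) ^ (2 * j))) ` {1..})}"
  then obtain a D where major: "\<And>j. norm (c j) \<le> norm (a j)"
    and "\<And>X z. v (norm z) * norm (tpoly (fl (X + 1)) a z) \<le> D"
    using bounded_blocks_majorant[of c] unfolding mem_Collect_eq by blast
  then have "a \<in> taylor_coeffs ` H_inf v" by (intro bounded_partial_sums_H_inf)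
  with major show "c \<in> solid_hull (taylor_coeffs ` H_inf v)" by (auto simp: solid_hull_def)
qed

end

theorem theorem2p5:
  fixes v :: "real \<Rightarrow> real" and r :: "real \<Rightarrow> real"
    and m :: "nat \<Rightarrow> real" and b K :: real
  assumes "weight v"
    and "max_points v r"
    and "0 < m 1"
    and "strict_mono_on {1..} m"
    and "filterlim m at_top sequentially"
    and "b > 2" and "K \<ge> b"
    and "\<And>n. n \<ge> 1 \<Longrightarrow>
           b \<le> min (A_quot v r (m n) (m (n + 1))) (B_quot v r (m n) (m (n + 1)))"
    and "\<And>n. n \<ge> 1 \<Longrightarrow>
           max (A_quot v r (m n) (m (n + 1))) (B_quot v r (m n) (m (n + 1))) \<le> K"
  shows "solid_hull (taylor_coeffs ` H_inf v) =
    {c :: nat \<Rightarrow> complex.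
       bdd_above ((\<lambda>n. v (r (m n)) *
         sqrt (\<Sum>j | m n < real j \<and> real j \<le> m (n + 1). (norm (c j))\<^sup>2 * r (m n) ^ (2 * j))) ` {1..})}"
proof -
  interpret lusky_sequence v r m b K
    by (rule lusky_sequence.intro) (fact assms)+
  show ?thesis by (rule solid_hull_eq)
qed

end
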